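(* Let $k$ be a commutative ring, $A$ a commutative $k$-algebra, $q\geq 2$ an integer, $\Delta\subseteq\mathbb{N}^q$ a finite co-ideal, non-empty and different from $\{0\}$, and $D\in \mathrm{HS}^q_k(A;\Delta)$ a $\Delta$-variate HS-derivation. Let $C:=\#(\mathcal{C}^q_\Delta)$, write $\mathcal{C}^q_\Delta=\{\beta^1,\ldots,\beta^C\}$ with $\beta^1\prec\beta^2\prec\cdots\prec\beta^C$, and let $m_i=m^\Delta_{\beta^i}$. Then there is a unique family $E^i\in \mathrm{HS}_k(A;m_i)$, $1\leq i\leq C$, such that $$D=\left(\psi_{\beta^1,\Delta}\bullet E^1\right)\circ\left(\psi_{\beta^2,\Delta}\bullet E^2\right)\circ\cdots\circ\left(\psi_{\beta^C,\Delta}\bullet E^C\right).$$ Moreover, if for some $a\in\{1,\dots,C\}$ there is $\alpha=(\alpha_1,\ldots,\alpha_q)\in P^\Delta_{\beta^a}$ such that $D_\gamma=0$ for all $\gamma\in\mathcal{S}^\Delta_{\beta^a}$ with $\gamma\leq\alpha$, then $E^a_r=D_{r\beta^a}$ for all $r=0,\ldots,\gcd(\alpha_1,\ldots,\alpha_q)$.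
   Context: Orders. $\mathbb{N}=\{0,1,2,\dots\}$, $\mathbb{N}_+=\mathbb{N}\setminus\{0\}$, $\mathbb{N}^q_+=\mathbb{N}^q\setminus\{(0,\ldots,0)\}$. $\leq$ on $\mathbb{N}^q$ is the componentwise partial order. A co-ideal of $\mathbb{N}^q$ is a subset $\Delta$ such that $\alpha\in\Delta$ and $\alpha'\leq\alpha$ imply $\alpha'\in\Delta$. $\gcd$ denotes the non-negative generator of the ideal of $\mathbb{Z}$ generated by the given integers. For $\alpha,\beta\in\mathbb{N}^q_+$, $\alpha\sim\beta$ iff $\beta=r\alpha$ for some $r\in\mathbb{Q}^\times$; $[\alpha]$ is the class. $\mathcal{C}^q=\{\beta\in\mathbb{N}^q_+ : \gcd(\beta_1,\ldots,\beta_q)=1\}$; each class contains exactly one element $\beta$ of $\mathcal{C}^q$, and $[\beta]=\{r\beta: r\in\mathbb{N}_+\}$. For $\beta\in\mathbb{N}^q$ put $g(\beta)=(0,0)$ if $\beta_1=\beta_2=0$ and $g(\beta)=\frac{1}{\gcd(\beta_1,\beta_2)}(\beta_1,\beta_2)$ otherwise. The total order $\preceq\,=\,\preceq^q$ on $\mathcal{C}^q$ is defined recursively by its strict part: for $q=2$, $\beta\prec^2\gamma$ iff $\gamma_2\beta_1<\gamma_1\beta_2$; for $q\geq3$, $\beta\prec^q\gamma$ iff one of the following holds: (1) $g(\beta)=(0,0)$ and $g(\gamma)\neq(0,0)$; (2) $g(\beta),g(\gamma)\neq(0,0)$ and $g(\beta)\prec^2 g(\gamma)$; (3) $g(\beta)=g(\gamma)$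 and $(\gcd(\beta_1,\beta_2),\beta_3,\ldots,\beta_q)\prec^{q-1}(\gcd(\gamma_1,\gamma_2),\gamma_3,\ldots,\gamma_q)$. Sets attached to $\Delta$. $\mathcal{C}^q_\Delta=\mathcal{C}^q\cap\Delta$. For $\beta\in\mathcal{C}^q_\Delta$: $P^\Delta_\beta=[\beta]\cap\Delta=\{n\beta\in\Delta: n\in\mathbb{N}_+\}$; $m^\Delta_\beta=\#P^\Delta_\beta\in\mathbb{N}_+\cup\{\infty\}$; $\mathcal{S}^\Delta_\beta=\bigsqcup_{\lambda\in\mathcal{C}^q_\Delta,\ \lambda\prec\beta}P^\Delta_\lambda$. HS-derivations. A $\Delta$-variate HS-derivation of $A$ over $k$ is a family $D=(D_\alpha)_{\alpha\in\Delta}$ of $k$-linear maps $A\to A$ with $D_0=\mathrm{Id}_A$ and $D_\alpha(xy)=\sum_{\beta+\gamma=\alpha}D_\beta(x)D_\gamma(y)$ for all $x,y\in A$, $\alpha\in\Delta$. The set of these is $\mathrm{HS}^q_k(A;\Delta)$; it is a group under $(D\circ E)_\alpha=\sum_{\beta+\gamma=\alpha}D_\beta\circ E_\gamma$. For $m\in\mathbb{N}_+\cup\{\infty\}$, $\mathrm{HS}_k(A;m)=\mathrm{HS}^1_k(A;\{n\in\mathbb{N}: n\leq m\})$. Substitution maps. For variables $\mathbf{s}=\{s_1,\dots,s_q\}$, $A[[\mathbf{s}]]_\Delta$ is the quotient of $A[[\mathbf{s}]]$ by the ideal of power series whose coefficients at all $\mathbf{s}^\alpha$, $\alpha\in\Delta$,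 vanish; $A[[\mu]]_m=A[[\mu]]_{\{n\in\mathbb{N}:n\leq m\}}$. For $\beta\in\mathcal{C}^q_\Delta$, $\psi_{\beta,\Delta}:A[[\mu]]_{m^\Delta_\beta}\to A[[\mathbf{s}]]_\Delta$ is the continuous $A$-algebra map with $\mu\mapsto s_1^{\beta_1}\cdots s_q^{\beta_q}$. An HS-derivation $E=(E_r)$ is identified with the series $\sum_r E_r\mu^r$, and $\psi_{\beta,\Delta}\bullet E=\sum_r\psi_{\beta,\Delta}(\mu^r)E_r\in \mathrm{HS}^q_k(A;\Delta)$; i.e. its component at $r\beta\in\Delta$ is $E_r$ and its other components are $0$. *)

theory Defs
  imports Main "HOL-Library.FuncSet" "HOL-Library.Extended_Nat"
begin

section \<open>Multi-indices\<close>

text \<open>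
  Elements of \<open>\<nat>\<^sup>q\<close> are lists of naturals of length \<open>q\<close>, because the order below is defined by
  recursion on \<open>q\<close>. \<open>map2\<close> truncates to the shorter list, so lengths are always fixed explicitly.
\<close>

definition Nvec :: "nat \<Rightarrow> nat list set" where
  "Nvec q = {\<alpha>. length \<alpha> = q}"

definition vzero :: "nat \<Rightarrow> nat list" where
  "vzero q = replicate q 0"

definition vadd :: "nat list \<Rightarrow> nat list \<Rightarrow> nat list" where
  "vadd \<alpha> \<beta> = map2 (+) \<alpha> \<beta>"

definition vscale :: "nat \<Rightarrow> nat list \<Rightarrow> nat list" where
  "vscale n \<alpha> = map ((*) n) \<alpha>"

definition vle :: "nat list \<Rightarrow> nat list \<Rightarrow> bool" where
  "vle \<alpha> \<beta> \<longleftrightarrow> list_all2 (\<le>) \<alpha> \<beta>"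

definition vgcd :: "nat list \<Rightarrow> nat" where
  "vgcd \<alpha> = Gcd (set \<alpha>)"

definition vsplits :: "nat \<Rightarrow> nat list \<Rightarrow> (nat list \<times> nat list) set" where
  "vsplits q \<alpha> = {(\<beta>, \<gamma>). \<beta> \<in> Nvec q \<and> \<gamma> \<in> Nvec q \<and> vadd \<beta> \<gamma> = \<alpha>}"

definition coideal :: "nat \<Rightarrow> nat list set \<Rightarrow> bool" where
  "coideal q \<Delta> \<longleftrightarrow> \<Delta> \<subseteq> Nvec q \<and> (\<forall>\<alpha>\<in>\<Delta>. \<forall>\<alpha>'\<in>Nvec q. vle \<alpha>' \<alpha> \<longrightarrow> \<alpha>' \<in> \<Delta>)"

definition primitive :: "nat \<Rightarrow> nat list set" where
  "primitive q = {\<beta> \<in> Nvec q. \<beta> \<noteq> vzero q \<and> vgcd \<beta> = 1}"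

definition prim_pair :: "nat \<Rightarrow> nat \<Rightarrow> nat \<times> nat" where
  "prim_pair b1 b2 =
     (if b1 = 0 \<and> b2 = 0 then (0, 0) else (b1 div gcd b1 b2, b2 div gcd b1 b2))"

definition prec2 :: "nat \<times> nat \<Rightarrow> nat \<times> nat \<Rightarrow> bool" where
  "prec2 \<beta> \<gamma> \<longleftrightarrow> snd \<gamma> * fst \<beta> < fst \<gamma> * snd \<beta>"

text \<open>
  The strict order \<open>\<prec>\<^sup>q\<close>; \<open>q\<close> is the common length of the two lists, and lists of different lengths
  or of length below 2 are never related.
\<close>

fun prec :: "nat list \<Rightarrow> nat list \<Rightarrow> bool" (infix "\<prec>" 50) where
  "[b1, b2] \<prec> [c1, c2] \<longleftrightarrow> prec2 (b1, b2) (c1, c2)"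
| "(b1 # b2 # b3 # bs) \<prec> (c1 # c2 # c3 # cs) \<longleftrightarrow>
     (prim_pair b1 b2 = (0, 0) \<and> prim_pair c1 c2 \<noteq> (0, 0))
   \<or> (prim_pair b1 b2 \<noteq> (0, 0) \<and> prim_pair c1 c2 \<noteq> (0, 0)
        \<and> prec2 (prim_pair b1 b2) (prim_pair c1 c2))
   \<or> (prim_pair b1 b2 = prim_pair c1 c2 \<and> (gcd b1 b2 # b3 # bs) \<prec> (gcd c1 c2 # c3 # cs))"
| "_ \<prec> _ \<longleftrightarrow> False"

section \<open>Sets attached to a co-ideal\<close>

definition prims :: "nat \<Rightarrow> nat list set \<Rightarrow> nat list set" where
  "prims q \<Delta> = primitive q \<inter> \<Delta>"

definition ray :: "nat list set \<Rightarrow> nat list \<Rightarrow> nat list set" where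
  "ray \<Delta> \<beta> = {vscale n \<beta> | n. n > 0} \<inter> \<Delta>"

definition ray_length :: "nat list set \<Rightarrow> nat list \<Rightarrow> enat" where
  "ray_length \<Delta> \<beta> = (if finite (ray \<Delta> \<beta>) then enat (card (ray \<Delta> \<beta>)) else \<infinity>)"

definition below :: "nat \<Rightarrow> nat list set \<Rightarrow> nat list \<Rightarrow> nat list set" where
  "below q \<Delta> \<beta> = (\<Union>\<kappa> \<in> {\<kappa> \<in> prims q \<Delta>. \<kappa> \<prec> \<beta>}. ray \<Delta> \<kappa>)"

section \<open>Algebras and Hasse--Schmidt derivations\<close>

text \<open>
  Commutative unital rings are types of sort \<open>{comm_ring, monoid_mult}\<close>: unlike \<open>comm_ring_1\<close> (which
  the locale \<open>module\<close> requires of the scalars), this admits the zero ring.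
\<close>

locale comm_algebra =
  fixes scale :: "'k::{comm_ring, monoid_mult} \<Rightarrow> 'a::{comm_ring, monoid_mult} \<Rightarrow> 'a"
  assumes scale_right_distrib: "scale c (x + y) = scale c x + scale c y"
    and scale_left_distrib: "scale (c + d) x = scale c x + scale d x"
    and scale_scale: "scale c (scale d x) = scale (c * d) x"
    and scale_one: "scale 1 x = x"
    and scale_mult_left: "scale c (x * y) = scale c x * y"

definition klinear :: "('k \<Rightarrow> 'a \<Rightarrow> 'a) \<Rightarrow> ('a::{comm_ring, monoid_mult} \<Rightarrow> 'a) \<Rightarrow> bool" where
  "klinear scale f \<longleftrightarrow>
     (\<forall>x y. f (x + y) = f x + f y) \<and> (\<forall>c x. f (scale c x) = scale c (f x))"

text \<open>
  Families indexed by \<open>\<Delta>\<close> are extensional functions (\<open>\<rightarrow>\<^sub>E\<close>), so that equality of families is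
  equality on \<open>\<Delta>\<close>.
\<close>

definition HS :: "('k \<Rightarrow> 'a \<Rightarrow> 'a) \<Rightarrow> nat \<Rightarrow> nat list set
    \<Rightarrow> (nat list \<Rightarrow> 'a::{comm_ring, monoid_mult} \<Rightarrow> 'a) set" where
  "HS scale q \<Delta> = {D \<in> \<Delta> \<rightarrow>\<^sub>E Collect (klinear scale).
     D (vzero q) = id \<and>
     (\<forall>\<alpha>\<in>\<Delta>. \<forall>x y. D \<alpha> (x * y) = (\<Sum>(\<beta>, \<gamma>)\<in>vsplits q \<alpha>. D \<beta> x * D \<gamma> y))}"

text \<open>Univariate HS-derivations: the component \<open>E\<^sub>r\<close> is \<open>E [r]\<close>.\<close>

definition HS1 :: "('k \<Rightarrow> 'a \<Rightarrow> 'a) \<Rightarrow> enat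
    \<Rightarrow> (nat list \<Rightarrow> 'a::{comm_ring, monoid_mult} \<Rightarrow> 'a) set" where
  "HS1 scale m = HS scale 1 {[n] | n. enat n \<le> m}"

definition HS_comp :: "nat \<Rightarrow> nat list set \<Rightarrow> (nat list \<Rightarrow> 'a \<Rightarrow> 'a)
    \<Rightarrow> (nat list \<Rightarrow> 'a \<Rightarrow> 'a) \<Rightarrow> nat list \<Rightarrow> 'a::{comm_ring, monoid_mult} \<Rightarrow> 'a" where
  "HS_comp q \<Delta> D E = (\<lambda>\<alpha>\<in>\<Delta>. \<lambda>x. \<Sum>(\<beta>, \<gamma>)\<in>vsplits q \<alpha>. D \<beta> (E \<gamma> x))"

definition HS_one :: "nat \<Rightarrow> nat list set
    \<Rightarrow> nat list \<Rightarrow> 'a::{comm_ring, monoid_mult} \<Rightarrow> 'a" where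
  "HS_one q \<Delta> = (\<lambda>\<alpha>\<in>\<Delta>. if \<alpha> = vzero q then id else (\<lambda>x. 0))"

definition HS_prod :: "nat \<Rightarrow> nat list set \<Rightarrow> (nat list \<Rightarrow> 'a \<Rightarrow> 'a) list
    \<Rightarrow> nat list \<Rightarrow> 'a::{comm_ring, monoid_mult} \<Rightarrow> 'a" where
  "HS_prod q \<Delta> Ds = foldr (HS_comp q \<Delta>) Ds (HS_one q \<Delta>)"

text \<open>
  \<open>\<psi>\<^bsub>\<beta>,\<Delta>\<^esub> \<bullet> E\<close>: the \<open>\<alpha>\<close>-component of \<open>\<Sum>\<^sub>r s\<^bsup>r\<beta>\<^esup> E\<^sub>r\<close>. As \<open>\<beta> \<noteq> 0\<close>, the sum has the single term \<open>E\<^sub>r\<close>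
  if \<open>\<alpha> = r\<beta>\<close>, and is empty (hence 0) if \<open>\<alpha>\<close> is not a multiple of \<open>\<beta>\<close>.
\<close>

definition psi_act :: "nat list set \<Rightarrow> nat list \<Rightarrow> (nat list \<Rightarrow> 'a \<Rightarrow> 'a)
    \<Rightarrow> nat list \<Rightarrow> 'a::{comm_ring, monoid_mult} \<Rightarrow> 'a" where
  "psi_act \<Delta> \<beta> E = (\<lambda>\<alpha>\<in>\<Delta>. \<lambda>x. \<Sum>r | vscale r \<beta> = \<alpha>. E [r] x)"

end

theory Submission
  imports Defs
begin

text \<open>
  Every nonzero \<open>\<alpha> \<in> \<Delta>\<close> lies on exactly one ray \<open>[\<beta>\<^sup>i]\<close>, say \<open>\<alpha> = r\<beta>\<^sup>i\<close>, and the component of the product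
  at \<open>\<alpha>\<close> is \<open>E\<^sup>i\<^sub>r\<close> plus an expression in components of smaller total degree. Hence the \<open>E\<^sup>i\<^sub>r\<close> exist and
  are unique as \<open>k\<close>-linear maps, by induction on the total degree of \<open>\<alpha>\<close>. The failure of the Leibniz
  rule in degree \<open>\<alpha>\<close> is additive under composition as long as the rule holds in smaller total degree,
  so the rule passes from \<open>D\<close> to the factors. The order on the rays enters only the last claim, through a
  convexity property: a sum of vectors that lie on the ray of \<open>\<beta>\<^sup>i\<close> or above it lies above it as soon
  as one of the summands does.
\<close>

section \<open>Multi-indices\<close>

text \<open>Convexity is proved for \<open>prec\<close> on all lists of a fixed length at least 2,
  since the sums that occur need not be primitive. The obstacle is the recursive clause, which
  replaces the first two entries by their gcd, and the gcd is not additive. It is additive on pairs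
  with the same primitive part, and only for such pairs is the clause reached. In the last claim
  convexity removes the factors after the \<open>a\<close>-th. Those before it are removed by the
  vanishing hypothesis: moving up through the rays, each of these factors turns out to be trivial at
  all nonzero indices \<le> \<alpha>, hence drops out at the left end of the product, and the
  components on the next ray can be read off from \<open>D\<close>.\<close>

lemma vadd_simps [simp]:
  "vadd [] \<beta> = []" "vadd (a # \<alpha>) (b # \<beta>) = (a + b) # vadd \<alpha> \<beta>"
  by (simp_all add: vadd_def)

lemma vscale_simps [simp]: "vscale n [] = []" "vscale n (a # \<alpha>) = (n * a) # vscale n \<alpha>"
  by (simp_all add: vscale_def)

lemma length_vadd [simp]: "length (vadd \<alpha> \<beta>) = min (length \<alpha>) (length \<beta>)"
  by (simp add: vadd_def)

lemma length_vscale [simp]: "length (vscale n \<alpha>) = length \<alpha>"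
  by (simp add: vscale_def)

lemma length_vzero [simp]: "length (vzero q) = q"
  by (simp add: vzero_def)

lemma nth_vadd [simp]: "i < length \<alpha> \<Longrightarrow> i < length \<beta> \<Longrightarrow> vadd \<alpha> \<beta> ! i = \<alpha> ! i + \<beta> ! i"
  by (simp add: vadd_def)

lemma nth_vscale [simp]: "i < length \<alpha> \<Longrightarrow> vscale n \<alpha> ! i = n * \<alpha> ! i"
  by (simp add: vscale_def)

lemma nth_vzero [simp]: "i < q \<Longrightarrow> vzero q ! i = 0"
  by (simp add: vzero_def)

lemma vadd_assoc: "vadd (vadd \<alpha> \<beta>) \<gamma> = vadd \<alpha> (vadd \<beta> \<gamma>)"
  by (rule nth_equalityI) auto

lemma vadd_commute: "vadd \<alpha> \<beta> = vadd \<beta> \<alpha>"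
  by (rule nth_equalityI) auto

lemma vadd_left_commute: "vadd \<alpha> (vadd \<beta> \<gamma>) = vadd \<beta> (vadd \<alpha> \<gamma>)"
  by (rule nth_equalityI) auto

lemma vadd_vzero: "length \<alpha> = q \<Longrightarrow> vadd (vzero q) \<alpha> = \<alpha>" "length \<alpha> = q \<Longrightarrow> vadd \<alpha> (vzero q) = \<alpha>"
  by (rule nth_equalityI; auto)+

lemma vscale_add: "vscale (m + n) \<alpha> = vadd (vscale m \<alpha>) (vscale n \<alpha>)"
  by (rule nth_equalityI) (auto simp: algebra_simps)

lemma vscale_0: "length \<alpha> = q \<Longrightarrow> vscale 0 \<alpha> = vzero q"
  by (rule nth_equalityI) auto

lemma vscale_1: "vscale (Suc 0) \<alpha> = \<alpha>"
  by (rule nth_equalityI) auto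

lemma sum_list_vadd: "length \<alpha> = length \<beta> \<Longrightarrow> sum_list (vadd \<alpha> \<beta>) = sum_list \<alpha> + sum_list \<beta>"
  by (induction \<alpha> \<beta> rule: list_induct2) auto

lemma sum_list_eq_0_iff_vzero: "length \<alpha> = q \<Longrightarrow> sum_list \<alpha> = 0 \<longleftrightarrow> \<alpha> = vzero q"
  unfolding vzero_def sum_list_eq_0_iff by (metis replicate_eqI in_set_replicate)

lemma vgcd_vscale: "vgcd (vscale n \<alpha>) = n * vgcd \<alpha>"
  by (induction \<alpha>) (auto simp: vgcd_def gcd_mult_left)

lemma vle_vscale: "m \<le> n \<Longrightarrow> vle (vscale m \<alpha>) (vscale n \<alpha>)"
  by (auto simp: vle_def list_all2_conv_all_nth)

lemma vle_trans: "vle \<alpha> \<beta> \<Longrightarrow> vle \<beta> \<gamma> \<Longrightarrow> vle \<alpha> \<gamma>"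
  unfolding vle_def by (rule list_all2_trans[of "(\<le>)" "(\<le>)" "(\<le>)"]) auto

lemma primitiveD:
  assumes "\<beta> \<in> primitive q"
  shows "length \<beta> = q" "\<beta> \<noteq> vzero q" "vgcd \<beta> = 1"
  using assms by (auto simp: primitive_def Nvec_def)

text \<open>The gcd of a multiple of a primitive vector is the multiplier itself. Hence a point of a
  ray determines its multiplier and, unless that is zero, its ray.\<close>

lemma vscale_primitive_eq_iff:
  assumes "\<beta> \<in> primitive q" "\<gamma> \<in> primitive q"
  shows "vscale r \<beta> = vscale s \<gamma> \<longleftrightarrow> r = s \<and> (r = 0 \<or> \<beta> = \<gamma>)"
proof
  assume eq: "vscale r \<beta> = vscale s \<gamma>"
  then have rs: "r = s"
    using vgcd_vscale[of r \<beta>] vgcd_vscale[of s \<gamma>] primitiveD(3)[OF assms(1)] primitiveD(3)[OF assms(2)]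
    by simp
  have "\<beta> = \<gamma>" if "r \<noteq> 0"
  proof (rule nth_equalityI)
    show "length \<beta> = length \<gamma>" using assms by (simp add: primitiveD)
    fix i assume "i < length \<beta>"
    then have "r * \<beta> ! i = r * \<gamma> ! i"
      using eq rs \<open>length \<beta> = length \<gamma>\<close> nth_vscale by metis
    then show "\<beta> ! i = \<gamma> ! i" using that by simp
  qed
  then show "r = s \<and> (r = 0 \<or> \<beta> = \<gamma>)" using rs by blast
next
  show "r = s \<and> (r = 0 \<or> \<beta> = \<gamma>) \<Longrightarrow> vscale r \<beta> = vscale s \<gamma>"
    using primitiveD[OF assms(1)] primitiveD[OF assms(2)] by (auto simp: vscale_0)
qed

lemma vscale_eq_vzero_iff:
  assumes "\<beta> \<in> primitive q"
  shows "vscale r \<beta> = vzero q \<longleftrightarrow> r = 0"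
  using vscale_primitive_eq_iff[OF assms assms, of r 0] primitiveD(1)[OF assms] by (simp add: vscale_0)

text \<open>The clause \<open>vle \<beta> \<alpha>\<close> puts the direction of a point of a
  co-ideal into the co-ideal, so that every nonzero point lies on one of the enumerated
  rays.\<close>

lemma obtain_primitive:
  assumes "length \<alpha> = q" "\<alpha> \<noteq> vzero q"
  obtains \<beta> where "\<beta> \<in> primitive q" "\<alpha> = vscale (vgcd \<alpha>) \<beta>" "vgcd \<alpha> > 0" "vle \<beta> \<alpha>"
proof
  let ?g = "vgcd \<alpha>" and ?\<beta> = "map (\<lambda>a. a div vgcd \<alpha>) \<alpha>"
  have "?g \<noteq> 0"
    using assms by (auto simp: vgcd_def vzero_def intro!: replicate_eqI)
  then show "?g > 0" by simp
  have dvd: "?g dvd a" if "a \<in> set \<alpha>" for a using that by (simp add: vgcd_def)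
  show eq: "\<alpha> = vscale ?g ?\<beta>"
    by (rule nth_equalityI) (use dvd in auto)
  have "vgcd ?\<beta> = 1"
    using eq vgcd_vscale[of ?g ?\<beta>] \<open>?g > 0\<close> by (metis mult_cancel1 mult.right_neutral less_not_refl)
  moreover have "?\<beta> \<noteq> vzero q"
  proof
    assume "?\<beta> = vzero q"
    then have "\<alpha> = vscale ?g (vzero q)" using eq by simp
    also have "\<dots> = vzero q" by (rule nth_equalityI) auto
    finally show False using assms by simp
  qed
  ultimately show "?\<beta> \<in> primitive q" using assms by (simp add: primitive_def Nvec_def)
  show "vle ?\<beta> \<alpha>" by (auto simp: vle_def list_all2_conv_all_nth)
qed

section \<open>Convexity of the order\<close>

lemma prim_pair_eq_0_iff [simp]: "prim_pair a b = (0, 0) \<longleftrightarrow> a = 0 \<and> b = 0"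
  by (auto simp: prim_pair_def dvd_div_eq_0_iff)

lemma prim_pair_mult:
  "a = gcd a b * fst (prim_pair a b) \<and> b = gcd a b * snd (prim_pair a b)"
  by (auto simp: prim_pair_def)

text \<open>Recovers the normal form from a factorization: a pair is \<open>d\<close> times a
  coprime pair in one way only. The zero pair takes part with \<open>d = 0\<close>, so that
  \<open>prim_pair_add\<close> covers it too.\<close>

lemma prim_pair_multiple:
  assumes "p = (0, 0) \<and> d = 0 \<or> gcd (fst p) (snd p) = 1 \<and> d > 0"
  shows "gcd (d * fst p) (d * snd p) = d" "prim_pair (d * fst p) (d * snd p) = p"
proof -
  show g: "gcd (d * fst p) (d * snd p) = d"
    using assms by (auto simp: gcd_mult_left)
  show "prim_pair (d * fst p) (d * snd p) = p"
    using assms g by (cases p) (auto simp: prim_pair_def)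
qed

lemma prim_pair_normal:
  "prim_pair a b = (0, 0) \<and> gcd a b = 0 \<or> gcd (fst (prim_pair a b)) (snd (prim_pair a b)) = 1 \<and> gcd a b > 0"
  by (auto simp: prim_pair_def div_gcd_coprime coprime_imp_gcd_eq_1)

text \<open>On the plane ray spanned by a primitive pair the gcd is the coordinate, hence additive
  there. This carries the recursive clause of \<open>prec\<close>, which keeps only the gcd of the
  first two entries, through sums.\<close>

lemma prim_pair_add:
  assumes "prim_pair a b = prim_pair c d"
  shows "gcd (a + c) (b + d) = gcd a b + gcd c d" "prim_pair (a + c) (b + d) = prim_pair a b"
proof -
  let ?p = "prim_pair a b"
  have "a = gcd a b * fst ?p" "b = gcd a b * snd ?p" "c = gcd c d * fst ?p" "d = gcd c d * snd ?p"
    using prim_pair_mult[of a b] prim_pair_mult[of c d] assms by metis+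
  then have "a + c = (gcd a b + gcd c d) * fst ?p" "b + d = (gcd a b + gcd c d) * snd ?p"
    by (metis distrib_right)+
  moreover have "?p = (0, 0) \<and> gcd a b + gcd c d = 0 \<or> gcd (fst ?p) (snd ?p) = 1 \<and> gcd a b + gcd c d > 0"
    using prim_pair_normal[of a b] prim_pair_normal[of c d] assms by auto
  ultimately show "gcd (a + c) (b + d) = gcd a b + gcd c d" "prim_pair (a + c) (b + d) = ?p"
    using prim_pair_multiple[of ?p "gcd a b + gcd c d"] by simp_all
qed

lemma prim_pair_eq_imp:
  assumes "prim_pair a b = prim_pair c d"
  shows "d * a = c * b" "a = 0 \<and> b = 0 \<longleftrightarrow> c = 0 \<and> d = 0"
proof -
  show "d * a = c * b"
  proof -
    let ?p = "prim_pair a b"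
    have "a = gcd a b * fst ?p" "b = gcd a b * snd ?p" "c = gcd c d * fst ?p" "d = gcd c d * snd ?p"
      using prim_pair_mult[of a b] prim_pair_mult[of c d] assms by metis+
    then have "d * a = (gcd c d * snd ?p) * (gcd a b * fst ?p)"
        "c * b = (gcd c d * fst ?p) * (gcd a b * snd ?p)"
      by presburger+
    then show ?thesis by (simp add: ac_simps)
  qed
  show "a = 0 \<and> b = 0 \<longleftrightarrow> c = 0 \<and> d = 0"
    using assms prim_pair_eq_0_iff by metis
qed

text \<open>The cross product inequality is homogeneous in both pairs, so the positive product of
  the two gcds cancels.\<close>

lemma prec2_prim_pair:
  assumes "\<not> (a = 0 \<and> b = 0)" "\<not> (c = 0 \<and> d = 0)"
  shows "prec2 (prim_pair a b) (prim_pair c d) \<longleftrightarrow> d * a < c * b"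
proof -
  obtain p1 p2 r1 r2 where p: "prim_pair a b = (p1, p2)" "prim_pair c d = (r1, r2)" by fastforce
  let ?g = "gcd a b" and ?h = "gcd c d"
  have "a = ?g * p1" "b = ?g * p2" "c = ?h * r1" "d = ?h * r2"
    using prim_pair_mult[of a b] prim_pair_mult[of c d] unfolding p fst_conv snd_conv by blast+
  then have "d * a = (?h * r2) * (?g * p1)" "c * b = (?h * r1) * (?g * p2)"
    by presburger+
  then have *: "d * a = (?g * ?h) * (r2 * p1)" "c * b = (?g * ?h) * (r1 * p2)"
    by (simp_all only: ac_simps)
  have "0 < ?g * ?h" using assms by (cases "a = 0"; cases "c = 0"; simp)
  then show ?thesis by (simp only: * p prec2_def fst_conv snd_conv mult_less_cancel1 simp_thms)
qed

text \<open>The form of the order used from here on, with cross products of the raw entries in place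
  of normalized pairs. A strict cross product inequality forces both pairs to be nonzero, which
  absorbs the nonvanishing conditions of the second clause.\<close>

lemma prec_Cons3:
  "b1 # b2 # b3 # bs \<prec> c1 # c2 # c3 # cs \<longleftrightarrow>
     (b1 = 0 \<and> b2 = 0 \<and> \<not> (c1 = 0 \<and> c2 = 0)) \<or> c2 * b1 < c1 * b2
   \<or> (prim_pair b1 b2 = prim_pair c1 c2 \<and> gcd b1 b2 # b3 # bs \<prec> gcd c1 c2 # c3 # cs)"
proof -
  have "c2 * b1 < c1 * b2 \<Longrightarrow> \<not> (b1 = 0 \<and> b2 = 0) \<and> \<not> (c1 = 0 \<and> c2 = 0)"
    by auto
  then show ?thesis
    unfolding prec.simps prim_pair_eq_0_iff using prec2_prim_pair[of b1 b2 c1 c2] by blast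
qed

text \<open>For a fixed leading pair of the smaller vector, the cross product comparison is the sign
  of a linear form in the other vector, so a strict inequality for one summand survives adding a
  weak one. If the fixed pair is zero, having a nonzero leading pair takes the place of the
  inequality. Only when both summands tie in the leading pair does the recursive clause decide, and
  then \<open>prim_pair_add\<close> reduces to a sum of shorter lists. Two entries are split off
  explicitly so that the gcd can become the new first entry in the induction on the tail.\<close>

lemma prec_vadd_aux:
  assumes "length cs = length bs" "length ds = length bs"
    and "b1 # b2 # bs \<prec> c1 # c2 # cs"
    and "b1 # b2 # bs \<prec> d1 # d2 # ds \<or> d1 # d2 # ds = b1 # b2 # bs"
  shows "b1 # b2 # bs \<prec> vadd (c1 # c2 # cs) (d1 # d2 # ds)"
  using assms
proof (induction bs arbitrary: b1 b2 c1 c2 d1 d2 cs ds)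
  case Nil
  then have "c2 * b1 < c1 * b2" "d2 * b1 \<le> d1 * b2" by (auto simp: prec2_def)
  then show ?case using Nil by (simp add: prec2_def distrib_right)
next
  case (Cons b3 bs)
  then obtain c3 cs' d3 ds' where eq: "cs = c3 # cs'" "ds = d3 # ds'"
    by (auto simp: length_Suc_conv)
  let ?c = "c1 = 0 \<and> c2 = 0" and ?d = "d1 = 0 \<and> d2 = 0" and ?b = "b1 = 0 \<and> b2 = 0"
  let ?bs = "gcd b1 b2 # b3 # bs"
  \<comment> \<open>\<open>R\<close> and \<open>S\<close> say that the comparison with the first,
    respectively second, summand ties in the leading pair and is settled later; \<open>S\<close>
    also admits equality, as the hypothesis on the second summand does.\<close>
  define R where "R \<longleftrightarrow> prim_pair b1 b2 = prim_pair c1 c2 \<and> ?bs \<prec> gcd c1 c2 # c3 # cs'"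
  define S where "S \<longleftrightarrow> prim_pair b1 b2 = prim_pair d1 d2 \<and>
    (?bs \<prec> gcd d1 d2 # d3 # ds' \<or> gcd d1 d2 # d3 # ds' = ?bs)"
  have c: "?b \<and> \<not> ?c \<or> c2 * b1 < c1 * b2 \<or> R"
    using Cons.prems(3) unfolding eq prec_Cons3 R_def by argo
  have d: "?b \<and> \<not> ?d \<or> d2 * b1 < d1 * b2 \<or> S"
  proof (cases "b1 # b2 # b3 # bs \<prec> d1 # d2 # ds")
    case True
    then show ?thesis unfolding eq prec_Cons3 S_def by argo
  next
    case False
    then have "d1 # d2 # ds = b1 # b2 # b3 # bs" using Cons.prems(4) by argo
    then show ?thesis unfolding eq S_def by simp
  qed
  show ?case
  proof (cases "R \<and> S")
    case True
    then have "?bs \<prec> vadd (gcd c1 c2 # c3 # cs') (gcd d1 d2 # d3 # ds')"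
      using Cons.prems(1,2) eq unfolding R_def S_def by (intro Cons.IH) auto
    moreover have "prim_pair c1 c2 = prim_pair d1 d2" "prim_pair b1 b2 = prim_pair c1 c2"
      using True unfolding R_def S_def by auto
    ultimately have "prim_pair b1 b2 = prim_pair (c1 + d1) (c2 + d2) \<and>
        ?bs \<prec> gcd (c1 + d1) (c2 + d2) # (c3 + d3) # vadd cs' ds'"
      using prim_pair_add[of c1 c2 d1 d2] by (simp only: vadd_simps simp_thms)
    then show ?thesis unfolding eq vadd_simps prec_Cons3 by argo
  next
    case False
    \<comment> \<open>A tie makes the cross products equal. If \<open>R \<and> S\<close> fails, at
      least one summand is therefore strictly decided by its leading pair.\<close>
    have R: "R \<Longrightarrow> c2 * b1 = c1 * b2" and S: "S \<Longrightarrow> d2 * b1 = d1 * b2"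
      unfolding R_def S_def using prim_pair_eq_imp(1) by blast+
    have "?b \<and> \<not> (c1 + d1 = 0 \<and> c2 + d2 = 0) \<or> (c2 + d2) * b1 < (c1 + d1) * b2"
    proof (cases ?b)
      case True
      then have "\<not> c2 * b1 < c1 * b2" "\<not> d2 * b1 < d1 * b2" by simp_all
      then have "\<not> ?c \<or> \<not> ?d" using c d False by argo
      then show ?thesis using True by auto
    next
      case b: False
      have "c2 * b1 < c1 * b2 \<and> d2 * b1 \<le> d1 * b2 \<or> c2 * b1 \<le> c1 * b2 \<and> d2 * b1 < d1 * b2"
        using c d b False R S by linarith
      then show ?thesis unfolding distrib_right by linarith
    qed
    then show ?thesis unfolding eq vadd_simps prec_Cons3 by argo
  qed
qed

lemma prec_vadd:
  assumes "\<beta> \<prec> \<gamma>" "\<beta> \<prec> \<delta> \<or> \<delta> = \<beta>"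
    and "length \<beta> = q" "length \<gamma> = q" "length \<delta> = q" "q \<ge> 2"
  shows "\<beta> \<prec> vadd \<gamma> \<delta>"
proof -
  have "\<exists>a b v. \<alpha> = a # b # v" if "length \<alpha> = q" for \<alpha> :: "nat list"
    using that assms(6) by (auto simp: numeral_2_eq_2 Suc_le_length_iff)
  then obtain b1 b2 bs c1 c2 cs d1 d2 ds
    where "\<beta> = b1 # b2 # bs" "\<gamma> = c1 # c2 # cs" "\<delta> = d1 # d2 # ds"
    using assms(3-5) by (metis (no_types))
  then show ?thesis using prec_vadd_aux assms by simp
qed

lemma prec_vadd_vscale:
  assumes "\<beta> \<prec> \<gamma>" and "length \<beta> = q" "length \<gamma> = q" "q \<ge> 2"
  shows "\<beta> \<prec> vadd \<gamma> (vscale n \<beta>)"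
proof (induction n)
  case 0
  then show ?case using assms by (simp add: vscale_0 vadd_vzero)
next
  case (Suc n)
  then have "\<beta> \<prec> vadd (vadd \<gamma> (vscale n \<beta>)) \<beta>"
    by (rule prec_vadd[where q = q]) (use assms in auto)
  then show ?case by (simp only: vscale_add[of n "Suc 0" \<beta>, unfolded add_Suc_right add_0_right vscale_1] vadd_assoc)
qed

lemma prec_vscale:
  assumes "\<beta> \<prec> \<gamma>" "n > 0" and "length \<beta> = q" "length \<gamma> = q" "q \<ge> 2"
  shows "\<beta> \<prec> vscale n \<gamma>"
  using assms(2)
proof (induction n rule: nat_induct_non_zero)
  case 1
  then show ?case using assms by (simp add: vscale_1)
next
  case (Suc n)
  from Suc.IH have "\<beta> \<prec> vadd (vscale n \<gamma>) \<gamma>"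
    by (rule prec_vadd[where q = q]) (use assms in auto)
  then show ?case using vscale_add[of n 1 \<gamma>] by (simp add: vscale_1)
qed

text \<open>All cross products vanish along a ray, and in the recursive clause the gcd is scaled by
  the same \<open>s\<close>, so the comparison is never decided. With
  \<open>prec_vadd_vscale\<close> it follows that a point of a ray is never the sum of a point of
  that ray and a vector above it.\<close>

lemma not_prec_vscale_self:
  assumes "s > 0" "length \<beta> \<ge> 2"
  shows "\<not> \<beta> \<prec> vscale s \<beta>"
proof
  assume less: "\<beta> \<prec> vscale s \<beta>"
  have "\<not> b1 # b2 # bs \<prec> vscale s (b1 # b2 # bs)" for b1 b2 bs
  proof (induction bs arbitrary: b1 b2)
    case Nil
    then show ?case by (simp add: prec2_def)
  next
    case (Cons b3 bs)
    have "gcd (s * b1) (s * b2) = s * gcd b1 b2" "s * b2 * b1 = s * b1 * b2"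
      by (simp_all add: gcd_mult_left)
    then show ?case using assms Cons.IH[of "gcd b1 b2" b3] unfolding vscale_simps prec_Cons3 by auto
  qed
  moreover obtain b1 b2 bs where "\<beta> = b1 # b2 # bs"
    using assms(2) by (cases \<beta>; cases "tl \<beta>") auto
  ultimately show False using less by blast
qed

section \<open>Sums over the decompositions \<alpha> = \<delta> + \<epsilon>\<close>

lemma sum_pairs_cong:
  "(\<And>a b. (a, b) \<in> S \<Longrightarrow> f a b = g a b) \<Longrightarrow> (\<Sum>(a, b)\<in>S. f a b) = (\<Sum>(a, b)\<in>S. g a b)"
  by (rule sum.cong) auto

lemma sum_list_neutral: "\<forall>a\<in>set as. f a = 0 \<Longrightarrow> (\<Sum>a\<leftarrow>as. f a) = (0 :: 'a::comm_monoid_add)"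
  by (induction as) auto

lemma vsplitsD:
  assumes "(\<delta>, \<epsilon>) \<in> vsplits q \<alpha>"
  shows "length \<delta> = q" "length \<epsilon> = q" "length \<alpha> = q" "\<alpha> = vadd \<delta> \<epsilon>"
    "sum_list \<alpha> = sum_list \<delta> + sum_list \<epsilon>" "vle \<delta> \<alpha>" "vle \<epsilon> \<alpha>"
  using assms
  by (auto simp: vsplits_def Nvec_def sum_list_vadd vle_def list_all2_conv_all_nth)

lemma finite_vsplits: "finite (vsplits q \<alpha>)"
proof (rule finite_subset)
  let ?L = "{\<delta>. set \<delta> \<subseteq> {..sum_list \<alpha>} \<and> length \<delta> = q}"
  have set: "set \<delta> \<subseteq> {..sum_list \<alpha>}" if "sum_list \<delta> \<le> sum_list \<alpha>" for \<delta>
    using that member_le_sum_list[of _ \<delta>] by fastforce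
  show "vsplits q \<alpha> \<subseteq> ?L \<times> ?L"
  proof (rule subrelI)
    fix \<delta> \<epsilon> assume "(\<delta>, \<epsilon>) \<in> vsplits q \<alpha>"
    from vsplitsD(1,2,5)[OF this] show "(\<delta>, \<epsilon>) \<in> ?L \<times> ?L" using set by simp
  qed
  show "finite (?L \<times> ?L)"
    using finite_lists_length_eq[of "{..sum_list \<alpha>}" q] by simp
qed

lemma vsplits_vzero: "vsplits q (vzero q) = {(vzero q, vzero q)}"
proof -
  have "\<delta> = vzero q \<and> \<epsilon> = vzero q" if "(\<delta>, \<epsilon>) \<in> vsplits q (vzero q)" for \<delta> \<epsilon>
  proof -
    have "sum_list \<delta> + sum_list \<epsilon> = 0"
      using vsplitsD(5)[OF that] sum_list_eq_0_iff_vzero[OF length_vzero, of q] by simp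
    then show ?thesis
      using sum_list_eq_0_iff_vzero vsplitsD(1,2)[OF that] by (metis add_is_0)
  qed
  moreover have "(vzero q, vzero q) \<in> vsplits q (vzero q)"
    by (simp add: vsplits_def Nvec_def vadd_vzero)
  ultimately show ?thesis by fast
qed

lemma vsplits_proper:
  assumes "(\<delta>, \<epsilon>) \<in> vsplits q \<alpha>" "(\<delta>, \<epsilon>) \<noteq> (\<alpha>, vzero q)" "(\<delta>, \<epsilon>) \<noteq> (vzero q, \<alpha>)"
  shows "sum_list \<delta> < sum_list \<alpha>" "sum_list \<epsilon> < sum_list \<alpha>"
proof -
  note s = vsplitsD[OF assms(1)]
  have "\<delta> \<noteq> vzero q" "\<epsilon> \<noteq> vzero q"
    using assms(2,3) s(4) vadd_vzero(1)[OF s(2)] vadd_vzero(2)[OF s(1)] by metis+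
  then have "sum_list \<delta> \<noteq> 0" "sum_list \<epsilon> \<noteq> 0"
    using sum_list_eq_0_iff_vzero[OF s(1)] sum_list_eq_0_iff_vzero[OF s(2)] by blast+
  then show "sum_list \<delta> < sum_list \<alpha>" "sum_list \<epsilon> < sum_list \<alpha>"
    using s(5) by linarith+
qed

text \<open>Splits off the two terms with a zero index. In the applications one factor is the
  identity there and the other has the full degree; by \<open>vsplits_proper\<close> all remaining
  terms involve smaller degrees only.\<close>

lemma sum_vsplits_ends:
  fixes f :: "nat list \<Rightarrow> nat list \<Rightarrow> 'a::comm_monoid_add"
  assumes "length \<alpha> = q" "\<alpha> \<noteq> vzero q"
  shows "(\<Sum>(\<delta>, \<epsilon>)\<in>vsplits q \<alpha>. f \<delta> \<epsilon>) = f \<alpha> (vzero q) + (f (vzero q) \<alpha> +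
    (\<Sum>(\<delta>, \<epsilon>)\<in>vsplits q \<alpha> - {(\<alpha>, vzero q)} - {(vzero q, \<alpha>)}. f \<delta> \<epsilon>))"
proof -
  have "(\<alpha>, vzero q) \<in> vsplits q \<alpha>" "(vzero q, \<alpha>) \<in> vsplits q \<alpha> - {(\<alpha>, vzero q)}"
    using assms by (auto simp: vsplits_def Nvec_def vadd_vzero)
  then show ?thesis
    by (simp only: sum.remove[OF finite_vsplits] sum.remove[OF finite_Diff[OF finite_vsplits]] prod.case)
qed

text \<open>Both sides run over the ways to write \<alpha> as a sum of four vectors and differ only
  in the grouping. For a composition of two families, evaluated on a product of two elements, the
  left side groups by family and the right side by element.\<close>

lemma sum_vsplits_interchange:
  fixes f :: "nat list \<Rightarrow> nat list \<Rightarrow> nat list \<Rightarrow> nat list \<Rightarrow> 'a::comm_monoid_add"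
  shows "(\<Sum>(\<delta>, \<epsilon>)\<in>vsplits q \<alpha>. \<Sum>(\<delta>1, \<delta>2)\<in>vsplits q \<delta>. \<Sum>(\<epsilon>1, \<epsilon>2)\<in>vsplits q \<epsilon>. f \<delta>1 \<delta>2 \<epsilon>1 \<epsilon>2)
    = (\<Sum>(\<eta>, \<theta>)\<in>vsplits q \<alpha>. \<Sum>(\<delta>1, \<epsilon>1)\<in>vsplits q \<eta>. \<Sum>(\<delta>2, \<epsilon>2)\<in>vsplits q \<theta>. f \<delta>1 \<delta>2 \<epsilon>1 \<epsilon>2)"
proof -
  let ?S = "SIGMA p:vsplits q \<alpha>. vsplits q (fst p) \<times> vsplits q (snd p)"
  have fin: "finite (vsplits q \<beta>)" for \<beta> by (rule finite_vsplits)
  have flat: "(\<Sum>(\<delta>, \<epsilon>)\<in>vsplits q \<alpha>. \<Sum>(a, b)\<in>vsplits q \<delta>. \<Sum>(c, d)\<in>vsplits q \<epsilon>. g a b c d)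
    = (\<Sum>(p, (a, b), (c, d))\<in>?S. g a b c d)" for g :: "nat list \<Rightarrow> nat list \<Rightarrow> nat list \<Rightarrow> nat list \<Rightarrow> 'a"
  proof -
    have "(\<Sum>(\<delta>, \<epsilon>)\<in>vsplits q \<alpha>. \<Sum>(a, b)\<in>vsplits q \<delta>. \<Sum>(c, d)\<in>vsplits q \<epsilon>. g a b c d)
      = (\<Sum>p\<in>vsplits q \<alpha>. \<Sum>((a, b), (c, d))\<in>vsplits q (fst p) \<times> vsplits q (snd p). g a b c d)"
      by (simp add: sum.cartesian_product split_def)
    also have "\<dots> = (\<Sum>(p, (a, b), (c, d))\<in>?S. g a b c d)"
      using fin by (intro sum.Sigma) auto
    finally show ?thesis .
  qed
  \<comment> \<open>Exchanging the two middle vectors and recomputing the outer pair is an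
    involution of the flattened index set.\<close>
  let ?h = "\<lambda>(p :: nat list \<times> nat list, (a, b), (c, d)). ((vadd a c, vadd b d), (a, c), (b, d))"
  have "bij_betw ?h ?S ?S"
  proof (rule bij_betw_byWitness[where f' = ?h])
    show "\<forall>s\<in>?S. ?h (?h s) = s" "\<forall>s\<in>?S. ?h (?h s) = s"
      by (auto simp: vsplits_def)
    show "?h ` ?S \<subseteq> ?S" "?h ` ?S \<subseteq> ?S"
      by (auto simp: vsplits_def Nvec_def vadd_assoc vadd_commute vadd_left_commute)
  qed
  then have "(\<Sum>s\<in>?S. (case s of (p, (a, b), (c, d)) \<Rightarrow> f a c b d) ) =
      (\<Sum>s\<in>?S. case ?h s of (p, (a, b), (c, d)) \<Rightarrow> f a c b d)"
    by (rule sum.reindex_bij_betw[symmetric])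
  also have "\<dots> = (\<Sum>(p, (a, b), (c, d))\<in>?S. f a b c d)"
    by (rule sum.cong) auto
  finally show ?thesis unfolding flat by (simp add: split_def)
qed

section \<open>Products of families of linear maps\<close>

lemma klinearI:
  "(\<And>x y. f (x + y) = f x + f y) \<Longrightarrow> (\<And>c x. f (scale c x) = scale c (f x)) \<Longrightarrow> klinear scale f"
  by (simp add: klinear_def)

lemma klinear_add: "klinear scale f \<Longrightarrow> f (x + y) = f x + f y"
  by (simp add: klinear_def)

lemma klinear_scale: "klinear scale f \<Longrightarrow> f (scale c x) = scale c (f x)"
  by (simp add: klinear_def)

lemma klinear_0: "klinear scale f \<Longrightarrow> f 0 = (0 :: 'a::{comm_ring, monoid_mult})"
  using klinear_add[of scale f 0 0] by simp

lemma klinear_sum: "klinear scale f \<Longrightarrow> f (sum g A) = (\<Sum>a\<in>A. f (g a))"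
  by (induction A rule: infinite_finite_induct) (simp_all add: klinear_0 klinear_add)

context comm_algebra
begin

lemma scale_zero: "scale c 0 = 0"
  using scale_right_distrib[of c 0 0] by simp

lemma scale_diff: "scale c (x - y) = scale c x - scale c y"
  using scale_right_distrib[of c "x - y" y] by (simp add: algebra_simps)

lemma scale_sum: "scale c (sum f A) = (\<Sum>a\<in>A. scale c (f a))"
  by (induction A rule: infinite_finite_induct) (simp_all add: scale_zero scale_right_distrib)

lemma klinear_id: "klinear scale id"
  by (simp add: klinear_def)

lemma klinear_zero: "klinear scale (\<lambda>x. 0)"
  by (simp add: klinear_def scale_zero)

lemma klinear_comp_sum:
  assumes "\<And>p. p \<in> S \<Longrightarrow> klinear scale (f p)" "\<And>p. p \<in> S \<Longrightarrow> klinear scale (g p)"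
  shows "klinear scale (\<lambda>x. \<Sum>p\<in>S. f p (g p x))"
proof (rule klinearI)
  show "(\<Sum>p\<in>S. f p (g p (x + y))) = (\<Sum>p\<in>S. f p (g p x)) + (\<Sum>p\<in>S. f p (g p y))" for x y
    unfolding sum.distrib[symmetric]
    by (rule sum.cong) (simp_all add: klinear_add[OF assms(1)] klinear_add[OF assms(2)])
  show "(\<Sum>p\<in>S. f p (g p (scale c x))) = scale c (\<Sum>p\<in>S. f p (g p x))" for c x
    unfolding scale_sum
    by (rule sum.cong) (simp_all add: klinear_scale[OF assms(1)] klinear_scale[OF assms(2)])
qed

text \<open>The shape of the correction made in \<open>exists_ray_components\<close>: the old
  component plus the part of \<open>D\<close> still missing.\<close>

lemma klinear_add_diff:
  assumes "klinear scale f" "klinear scale g" "klinear scale h"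
  shows "klinear scale (\<lambda>x. f x + (g x - h x))"
  using assms by (simp add: klinear_def scale_right_distrib scale_diff algebra_simps)

end

text \<open>A difference rather than a predicate: the argument adds up the defects of several
  factors in a degree in which none of them is yet known to satisfy the rule.\<close>

definition leibniz_defect :: "nat \<Rightarrow> (nat list \<Rightarrow> 'a \<Rightarrow> 'a) \<Rightarrow> nat list \<Rightarrow> 'a \<Rightarrow> 'a \<Rightarrow> 'a::{comm_ring, monoid_mult}"
  where "leibniz_defect q G \<alpha> x y = G \<alpha> (x * y) - (\<Sum>(\<delta>, \<epsilon>)\<in>vsplits q \<alpha>. G \<delta> x * G \<epsilon> y)"

lemma leibniz_defect_vzero: "G (vzero q) = id \<Longrightarrow> leibniz_defect q G (vzero q) x y = 0"
  by (simp add: leibniz_defect_def vsplits_vzero)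

lemma HS_prod_Nil [simp]: "HS_prod q \<Delta> [] = HS_one q \<Delta>"
  by (simp add: HS_prod_def)

lemma HS_prod_Cons [simp]: "HS_prod q \<Delta> (G # Gs) = HS_comp q \<Delta> G (HS_prod q \<Delta> Gs)"
  by (simp add: HS_prod_def)

section \<open>Products over a fixed co-ideal: comparison by degree and Leibniz defects\<close>

locale pointed_coideal =
  fixes q :: nat and \<Delta> :: "nat list set"
  assumes coideal: "coideal q \<Delta>" and vzero_in: "vzero q \<in> \<Delta>"
begin

lemma length_in: "\<alpha> \<in> \<Delta> \<Longrightarrow> length \<alpha> = q"
  using coideal by (auto simp: coideal_def Nvec_def)

lemma vle_in:
  assumes "\<alpha> \<in> \<Delta>" "vle \<gamma> \<alpha>"
  shows "\<gamma> \<in> \<Delta>"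
proof -
  have "length \<gamma> = q"
    using assms length_in[OF assms(1)] list_all2_lengthD unfolding vle_def by metis
  then show ?thesis
    using coideal assms unfolding coideal_def Nvec_def by blast
qed

lemma vsplits_in:
  assumes "\<alpha> \<in> \<Delta>" "(\<delta>, \<epsilon>) \<in> vsplits q \<alpha>"
  shows "\<delta> \<in> \<Delta>" "\<epsilon> \<in> \<Delta>"
  using vle_in[OF assms(1)] vsplitsD(6,7)[OF assms(2)] by simp_all

lemma HS_comp_apply:
  "\<alpha> \<in> \<Delta> \<Longrightarrow> HS_comp q \<Delta> G H \<alpha> x = (\<Sum>(\<delta>, \<epsilon>)\<in>vsplits q \<alpha>. G \<delta> (H \<epsilon> x))"
  by (simp add: HS_comp_def)

lemma HS_prod_vzero:
  assumes "\<forall>G\<in>set Gs. G (vzero q) = id"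
  shows "HS_prod q \<Delta> Gs (vzero q) = id"
  using assms
proof (induction Gs)
  case Nil
  then show ?case by (simp add: HS_one_def vzero_in)
next
  case (Cons G Gs)
  then have "G (vzero q) = id" "HS_prod q \<Delta> Gs (vzero q) = id" by (meson list.set_intros)+
  then show ?case using vzero_in by (simp add: HS_comp_def vsplits_vzero fun_eq_iff del: eq_id_iff)
qed

lemma HS_prod_outside: "\<alpha> \<notin> \<Delta> \<Longrightarrow> HS_prod q \<Delta> Gs \<alpha> = undefined"
  by (cases Gs) (simp_all add: HS_one_def HS_comp_def)

text \<open>The unknown components of degree \<open>\<alpha>\<close> enter the degree \<open>\<alpha>\<close> component of a product
  additively; this makes the factorization solvable degree by degree.\<close>

lemma HS_prod_diff:
  assumes "\<alpha> \<in> \<Delta>" "\<alpha> \<noteq> vzero q"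
    and "\<And>i. i \<in> set is \<Longrightarrow> G i (vzero q) = id" "\<And>i. i \<in> set is \<Longrightarrow> G' i (vzero q) = id"
    and "\<And>i \<delta>. i \<in> set is \<Longrightarrow> \<delta> \<in> \<Delta> \<Longrightarrow> sum_list \<delta> < sum_list \<alpha> \<Longrightarrow> G i \<delta> = G' i \<delta>"
  shows "HS_prod q \<Delta> (map G is) \<alpha> x - HS_prod q \<Delta> (map G' is) \<alpha> x
    = (\<Sum>i\<leftarrow>is. G i \<alpha> x - G' i \<alpha> x)"
  using assms
proof (induction "is" arbitrary: \<alpha> x)
  case Nil
  then show ?case by simp
next
  case (Cons i "is")
  let ?P = "HS_prod q \<Delta> (map G is)" and ?P' = "HS_prod q \<Delta> (map G' is)"
  have zero: "?P (vzero q) = id" "?P' (vzero q) = id"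
    by (rule HS_prod_vzero, use Cons.prems(3,4) in force)+
  \<comment> \<open>In smaller degree the induction hypothesis expresses the difference of the tails
    as a sum of zeros.\<close>
  have agree: "?P \<delta> = ?P' \<delta>" if "\<delta> \<in> \<Delta>" "sum_list \<delta> < sum_list \<alpha>" for \<delta>
  proof (cases "\<delta> = vzero q")
    case True
    then show ?thesis using zero by simp
  next
    case False
    have "?P \<delta> x - ?P' \<delta> x = (\<Sum>i\<leftarrow>is. G i \<delta> x - G' i \<delta> x)" for x
      using that False Cons.prems by (intro Cons.IH) auto
    moreover have "(\<Sum>i\<leftarrow>is. G i \<delta> x - G' i \<delta> x) = 0" for x
      using that Cons.prems(5) by (intro sum_list_neutral ballI) auto
    ultimately show ?thesis by (auto simp: fun_eq_iff)
  qed
  have "(\<Sum>(\<delta>, \<epsilon>)\<in>vsplits q \<alpha> - {(\<alpha>, vzero q)} - {(vzero q, \<alpha>)}. G i \<delta> (?P \<epsilon> x))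
      = (\<Sum>(\<delta>, \<epsilon>)\<in>vsplits q \<alpha> - {(\<alpha>, vzero q)} - {(vzero q, \<alpha>)}. G' i \<delta> (?P' \<epsilon> x))"
  proof (rule sum_pairs_cong)
    fix \<delta> \<epsilon> assume "(\<delta>, \<epsilon>) \<in> vsplits q \<alpha> - {(\<alpha>, vzero q)} - {(vzero q, \<alpha>)}"
    then have *: "(\<delta>, \<epsilon>) \<in> vsplits q \<alpha>" "(\<delta>, \<epsilon>) \<noteq> (\<alpha>, vzero q)" "(\<delta>, \<epsilon>) \<noteq> (vzero q, \<alpha>)"
      by simp_all
    then show "G i \<delta> (?P \<epsilon> x) = G' i \<delta> (?P' \<epsilon> x)"
      using vsplits_proper[OF *] vsplits_in[OF Cons.prems(1) *(1)] agree Cons.prems(5)[of i \<delta>] by simp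
  qed
  then have "HS_prod q \<Delta> (map G (i # is)) \<alpha> x - HS_prod q \<Delta> (map G' (i # is)) \<alpha> x
      = (G i \<alpha> x - G' i \<alpha> x) + (?P \<alpha> x - ?P' \<alpha> x)"
    using Cons.prems zero by (simp add: HS_comp_apply sum_vsplits_ends length_in)
  also have "?P \<alpha> x - ?P' \<alpha> x = (\<Sum>i\<leftarrow>is. G i \<alpha> x - G' i \<alpha> x)"
    using Cons.prems by (intro Cons.IH) auto
  finally show ?case by simp
qed

text \<open>When the component at \<open>x * y\<close> is expanded, the rule applies to both factors
  in all terms except the two with a zero index; there one factor is the identity and the other
  contributes its unknown defect. What is left is a sum over four indices, and
  \<open>sum_vsplits_interchange\<close> identifies it with the convolution of the components at
  \<open>x\<close> and at \<open>y\<close>.\<close>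

lemma leibniz_defect_HS_comp:
  assumes "\<alpha> \<in> \<Delta>" "\<alpha> \<noteq> vzero q" "G (vzero q) = id" "H (vzero q) = id"
    and "\<And>\<delta>. \<delta> \<in> \<Delta> \<Longrightarrow> klinear scale (G \<delta>)"
    and "\<And>\<delta> x y. \<delta> \<in> \<Delta> \<Longrightarrow> sum_list \<delta> < sum_list \<alpha> \<Longrightarrow> leibniz_defect q G \<delta> x y = 0"
    and "\<And>\<delta> x y. \<delta> \<in> \<Delta> \<Longrightarrow> sum_list \<delta> < sum_list \<alpha> \<Longrightarrow> leibniz_defect q H \<delta> x y = 0"
  shows "leibniz_defect q (HS_comp q \<Delta> G H) \<alpha> x y = leibniz_defect q G \<alpha> x y + leibniz_defect q H \<alpha> x y"
proof -
  let ?K = "HS_comp q \<Delta> G H"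
  let ?t = "\<lambda>\<delta> \<epsilon>. \<Sum>(\<delta>1, \<delta>2)\<in>vsplits q \<delta>. \<Sum>(\<epsilon>1, \<epsilon>2)\<in>vsplits q \<epsilon>. G \<delta>1 (H \<epsilon>1 x) * G \<delta>2 (H \<epsilon>2 y)"
  let ?S = "vsplits q \<alpha> - {(\<alpha>, vzero q)} - {(vzero q, \<alpha>)}"
  have \<alpha>: "length \<alpha> = q" using assms length_in by blast
  have "(\<Sum>(\<delta>, \<epsilon>)\<in>?S. G \<delta> (H \<epsilon> (x * y))) = (\<Sum>(\<delta>, \<epsilon>)\<in>?S. ?t \<delta> \<epsilon>)"
  proof (rule sum_pairs_cong)
    fix \<delta> \<epsilon> assume "(\<delta>, \<epsilon>) \<in> vsplits q \<alpha> - {(\<alpha>, vzero q)} - {(vzero q, \<alpha>)}"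
    then have *: "(\<delta>, \<epsilon>) \<in> vsplits q \<alpha>" "(\<delta>, \<epsilon>) \<noteq> (\<alpha>, vzero q)" "(\<delta>, \<epsilon>) \<noteq> (vzero q, \<alpha>)"
      by simp_all
    have G: "G \<delta> (u * v) = (\<Sum>(\<delta>1, \<delta>2)\<in>vsplits q \<delta>. G \<delta>1 u * G \<delta>2 v)" for u v
      using assms(6)[of \<delta> u v] vsplits_proper[OF *] vsplits_in[OF assms(1) *(1)]
      by (simp add: leibniz_defect_def)
    have H: "H \<epsilon> (x * y) = (\<Sum>(\<epsilon>1, \<epsilon>2)\<in>vsplits q \<epsilon>. H \<epsilon>1 x * H \<epsilon>2 y)"
      using assms(7)[of \<epsilon> x y] vsplits_proper[OF *] vsplits_in[OF assms(1) *(1)]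
      by (simp add: leibniz_defect_def)
    have "G \<delta> (H \<epsilon> (x * y)) = (\<Sum>(\<epsilon>1, \<epsilon>2)\<in>vsplits q \<epsilon>. G \<delta> (H \<epsilon>1 x * H \<epsilon>2 y))"
      using klinear_sum[OF assms(5)] vsplits_in[OF assms(1) *(1)] by (simp add: H split_def)
    also have "\<dots> = ?t \<delta> \<epsilon>"
      unfolding G split_def by (rule sum.swap)
    finally show "G \<delta> (H \<epsilon> (x * y)) = ?t \<delta> \<epsilon>" .
  qed
  moreover have "G \<alpha> (H (vzero q) (x * y)) = leibniz_defect q G \<alpha> x y + ?t \<alpha> (vzero q)"
    using assms(4) by (simp add: leibniz_defect_def vsplits_vzero)
  moreover have "G (vzero q) (H \<alpha> (x * y)) = leibniz_defect q H \<alpha> x y + ?t (vzero q) \<alpha>"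
    using assms(3) by (simp add: leibniz_defect_def vsplits_vzero)
  ultimately have "?K \<alpha> (x * y) = leibniz_defect q G \<alpha> x y + leibniz_defect q H \<alpha> x y
      + (\<Sum>(\<delta>, \<epsilon>)\<in>vsplits q \<alpha>. ?t \<delta> \<epsilon>)"
    unfolding HS_comp_apply[OF assms(1)] sum_vsplits_ends[OF \<alpha> assms(2)] by (simp only: ac_simps)
  moreover have "(\<Sum>(\<eta>, \<theta>)\<in>vsplits q \<alpha>. ?K \<eta> x * ?K \<theta> y) = (\<Sum>(\<delta>, \<epsilon>)\<in>vsplits q \<alpha>. ?t \<delta> \<epsilon>)"
  proof (subst sum_vsplits_interchange, rule sum_pairs_cong)
    fix \<eta> \<theta> assume "(\<eta>, \<theta>) \<in> vsplits q \<alpha>"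
    then have "\<eta> \<in> \<Delta>" "\<theta> \<in> \<Delta>" using vsplits_in assms(1) by blast+
    then show "?K \<eta> x * ?K \<theta> y =
        (\<Sum>(\<delta>1, \<epsilon>1)\<in>vsplits q \<eta>. \<Sum>(\<delta>2, \<epsilon>2)\<in>vsplits q \<theta>. G \<delta>1 (H \<epsilon>1 x) * G \<delta>2 (H \<epsilon>2 y))"
      by (simp add: HS_comp_apply sum_product split_def)
  qed
  ultimately show ?thesis by (simp add: leibniz_defect_def)
qed

lemma klinear_HS_prod:
  assumes "comm_algebra scale" "\<alpha> \<in> \<Delta>"
    and "\<And>G \<delta>. G \<in> set Gs \<Longrightarrow> \<delta> \<in> \<Delta> \<Longrightarrow> klinear scale (G \<delta>)"
  shows "klinear scale (HS_prod q \<Delta> Gs \<alpha>)"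
proof -
  interpret comm_algebra scale by fact
  show ?thesis using assms(2,3)
  proof (induction Gs arbitrary: \<alpha>)
    case Nil
    then show ?case by (simp add: HS_one_def klinear_id klinear_zero)
  next
    case (Cons G Gs)
    let ?P = "HS_prod q \<Delta> Gs"
    have "klinear scale (\<lambda>x. \<Sum>p\<in>vsplits q \<alpha>. G (fst p) (?P (snd p) x))"
    proof (rule klinear_comp_sum[where f = "\<lambda>p. G (fst p)" and g = "\<lambda>p. ?P (snd p)"])
      show "klinear scale (G (fst p))" if "p \<in> vsplits q \<alpha>" for p
        using that vsplits_in(1)[OF Cons.prems(1), of "fst p" "snd p"] Cons.prems(2)[of G] by simp
      show "klinear scale (?P (snd p))" if "p \<in> vsplits q \<alpha>" for p
      proof (rule Cons.IH)
        show "snd p \<in> \<Delta>" using that vsplits_in(2)[OF Cons.prems(1), of "fst p" "snd p"] by simp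
        show "klinear scale (H \<delta>)" if "H \<in> set Gs" "\<delta> \<in> \<Delta>" for H \<delta>
          using that Cons.prems(2) by simp
      qed
    qed
    then show ?case using Cons.prems(1) by (simp add: HS_comp_def split_def)
  qed
qed

lemma leibniz_defect_HS_one:
  assumes "\<alpha> \<in> \<Delta>"
  shows "leibniz_defect q (HS_one q \<Delta>) \<alpha> x y = (0 :: 'a::{comm_ring, monoid_mult})"
proof (cases "\<alpha> = vzero q")
  case True
  then show ?thesis using vzero_in by (simp add: leibniz_defect_def vsplits_vzero HS_one_def)
next
  case False
  have "(\<Sum>(\<delta>, \<epsilon>)\<in>vsplits q \<alpha>. HS_one q \<Delta> \<delta> x * HS_one q \<Delta> \<epsilon> y) = 0"
  proof (rule sum.neutral, clarify)
    fix \<delta> \<epsilon> assume *: "(\<delta>, \<epsilon>) \<in> vsplits q \<alpha>"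
    then have "\<delta> \<noteq> vzero q \<or> \<epsilon> \<noteq> vzero q" using False vsplitsD(4)[OF *] vadd_vzero(1)[OF length_vzero, of q] by blast
    then show "HS_one q \<Delta> \<delta> x * HS_one q \<Delta> \<epsilon> y = 0"
      using vsplits_in[OF assms *] by (auto simp: HS_one_def)
  qed
  then show ?thesis using False assms by (simp add: leibniz_defect_def HS_one_def)
qed

text \<open>By induction the defect of the tail in each smaller degree is a sum of zeros, so the
  hypotheses of \<open>leibniz_defect_HS_comp\<close> hold and the head can be split off. This is
  why \<alpha> varies in the induction.\<close>

lemma leibniz_defect_HS_prod:
  assumes "comm_algebra scale" "\<alpha> \<in> \<Delta>" "\<alpha> \<noteq> vzero q"
    and "\<And>G. G \<in> set Gs \<Longrightarrow> G (vzero q) = id"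
    and "\<And>G \<delta>. G \<in> set Gs \<Longrightarrow> \<delta> \<in> \<Delta> \<Longrightarrow> klinear scale (G \<delta>)"
    and "\<And>G \<delta> x y. G \<in> set Gs \<Longrightarrow> \<delta> \<in> \<Delta> \<Longrightarrow> sum_list \<delta> < sum_list \<alpha> \<Longrightarrow> leibniz_defect q G \<delta> x y = 0"
  shows "leibniz_defect q (HS_prod q \<Delta> Gs) \<alpha> x y = (\<Sum>G\<leftarrow>Gs. leibniz_defect q G \<alpha> x y)"
  using assms(2-)
proof (induction Gs arbitrary: \<alpha> x y)
  case Nil
  then show ?case by (simp add: leibniz_defect_HS_one)
next
  case (Cons G Gs)
  let ?P = "HS_prod q \<Delta> Gs"
  have zero: "?P (vzero q) = id"
    by (rule HS_prod_vzero) (meson Cons.prems(3) list.set_intros(2))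
  have "leibniz_defect q ?P \<delta> x y = 0" if "\<delta> \<in> \<Delta>" "sum_list \<delta> < sum_list \<alpha>" for \<delta> x y
  proof (cases "\<delta> = vzero q")
    case True
    then show ?thesis using leibniz_defect_vzero[of ?P, OF zero] by (simp only:)
  next
    case False
    have "leibniz_defect q ?P \<delta> x y = (\<Sum>G\<leftarrow>Gs. leibniz_defect q G \<delta> x y)"
      using that False Cons.prems by (intro Cons.IH) auto
    also have "\<dots> = 0" using that Cons.prems(5) by (intro sum_list_neutral ballI) auto
    finally show ?thesis .
  qed
  then have "leibniz_defect q (HS_comp q \<Delta> G ?P) \<alpha> x y = leibniz_defect q G \<alpha> x y + leibniz_defect q ?P \<alpha> x y"
    using Cons.prems zero by (intro leibniz_defect_HS_comp[where scale = scale]) auto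
  then show ?case using Cons by simp
qed

end

section \<open>Families supported on one ray\<close>

lemma sum_list_single:
  fixes f :: "'b \<Rightarrow> 'a::comm_monoid_add"
  assumes "distinct as" "a \<in> set as" "\<And>b. b \<in> set as \<Longrightarrow> b \<noteq> a \<Longrightarrow> f b = 0"
  shows "(\<Sum>b\<leftarrow>as. f b) = f a"
proof -
  have "(\<Sum>b\<leftarrow>as. f b) = sum f (set as)"
    using assms(1) by (rule sum_list_distinct_conv_sum_set)
  also have "\<dots> = f a + sum f (set as - {a})"
    using assms(2) by (intro sum.remove) simp_all
  also have "sum f (set as - {a}) = 0"
    by (rule sum.neutral) (use assms(3) in blast)
  finally show ?thesis by simp
qed

lemma HS_iff:
  "D \<in> HS scale q \<Delta> \<longleftrightarrow> D \<in> \<Delta> \<rightarrow>\<^sub>E Collect (klinear scale) \<and> D (vzero q) = id \<and>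
    (\<forall>\<alpha>\<in>\<Delta>. \<forall>x y. leibniz_defect q D \<alpha> x y = 0)"
  by (simp add: HS_def leibniz_defect_def)

lemma vsplits_1_iff: "(\<sigma>, \<tau>) \<in> vsplits 1 [r] \<longleftrightarrow> (\<exists>s t. \<sigma> = [s] \<and> \<tau> = [t] \<and> s + t = r)"
  by (auto simp: vsplits_def Nvec_def length_Suc_conv)

lemma vsplits_1E:
  assumes "p \<in> vsplits 1 [r]"
  obtains s t where "p = ([s], [t])" "s + t = r"
  using assms vsplits_1_iff[of "fst p" "snd p" r] by (cases p) auto

context pointed_coideal
begin

lemma psi_act_vscale:
  assumes "\<beta> \<in> primitive q" "vscale r \<beta> \<in> \<Delta>"
  shows "psi_act \<Delta> \<beta> E (vscale r \<beta>) = E [r]"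
proof -
  have "{s. vscale s \<beta> = vscale r \<beta>} = {r}"
    using vscale_primitive_eq_iff[OF assms(1) assms(1)] by blast
  then show ?thesis using assms(2) by (simp add: psi_act_def)
qed

lemma psi_act_off_ray:
  assumes "\<alpha> \<in> \<Delta>" "\<forall>r. vscale r \<beta> \<noteq> \<alpha>"
  shows "psi_act \<Delta> \<beta> E \<alpha> = (\<lambda>x. 0)"
  using assms by (simp add: psi_act_def)

lemma psi_act_vzero:
  assumes "\<beta> \<in> primitive q" "E [0] = id"
  shows "psi_act \<Delta> \<beta> E (vzero q) = id"
  using psi_act_vscale[OF assms(1), of 0 E] vscale_0[OF primitiveD(1)[OF assms(1)]] vzero_in assms(2)
  by metis

lemma psi_act_cong:
  assumes "\<And>r. vscale r \<beta> \<in> \<Delta> \<Longrightarrow> E [r] = E' [r]"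
  shows "psi_act \<Delta> \<beta> E = psi_act \<Delta> \<beta> E'"
proof
  fix \<alpha>
  have "(\<Sum>r | vscale r \<beta> = \<alpha>. E [r] x) = (\<Sum>r | vscale r \<beta> = \<alpha>. E' [r] x)" if "\<alpha> \<in> \<Delta>" for x
    using assms that by (intro sum.cong) simp_all
  then show "psi_act \<Delta> \<beta> E \<alpha> = psi_act \<Delta> \<beta> E' \<alpha>"
    by (simp add: psi_act_def)
qed

lemma klinear_psi_act:
  assumes "comm_algebra scale" "\<beta> \<in> primitive q" "\<alpha> \<in> \<Delta>"
    and "\<And>r. vscale r \<beta> \<in> \<Delta> \<Longrightarrow> klinear scale (E [r])"
  shows "klinear scale (psi_act \<Delta> \<beta> E \<alpha>)"
proof (cases "\<exists>r. vscale r \<beta> = \<alpha>")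
  case True
  then obtain r where "vscale r \<beta> = \<alpha>" ..
  then show ?thesis using psi_act_vscale[OF assms(2), of r E] assms(3,4) by simp
next
  case False
  then show ?thesis
    using psi_act_off_ray[OF assms(3), of \<beta> E] comm_algebra.klinear_zero[OF assms(1)] by simp
qed

text \<open>Decompositions of a point of the ray into two points of the ray correspond to
  decompositions of the multiplier; any other decomposition has a part off the ray and contributes
  zero. Thus the rule in \<open>q\<close> variables along the ray is the rule in one
  variable.\<close>

lemma leibniz_defect_psi_act:
  assumes "\<beta> \<in> primitive q" "vscale r \<beta> \<in> \<Delta>"
  shows "leibniz_defect q (psi_act \<Delta> \<beta> E) (vscale r \<beta>) x y = leibniz_defect 1 E [r] x y"
proof -
  let ?G = "psi_act \<Delta> \<beta> E" and ?h = "\<lambda>(\<sigma>, \<tau>). (vscale (hd \<sigma>) \<beta>, vscale (hd \<tau>) \<beta>)"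
  let ?S = "vsplits q (vscale r \<beta>)"
  have len: "length \<beta> = q" using assms(1) by (rule primitiveD)
  have inj: "inj_on ?h (vsplits 1 [r])"
  proof (rule inj_onI)
    fix p p' assume p: "p \<in> vsplits 1 [r]" "p' \<in> vsplits 1 [r]" and eq: "?h p = ?h p'"
    obtain s t where st: "p = ([s], [t])" using vsplits_1E[OF p(1)] .
    obtain s' t' where st': "p' = ([s'], [t'])" using vsplits_1E[OF p(2)] .
    have "vscale s \<beta> = vscale s' \<beta>" "vscale t \<beta> = vscale t' \<beta>"
      using eq unfolding st st' by simp_all
    then have "s = s'" "t = t'"
      using vscale_primitive_eq_iff[OF assms(1) assms(1), of s s']
        vscale_primitive_eq_iff[OF assms(1) assms(1), of t t'] by blast+
    then show "p = p'" unfolding st st' by (simp only:)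
  qed
  have "(\<Sum>(\<delta>, \<epsilon>)\<in>?S. ?G \<delta> x * ?G \<epsilon> y) = (\<Sum>(\<delta>, \<epsilon>)\<in>?h ` vsplits 1 [r]. ?G \<delta> x * ?G \<epsilon> y)"
  proof (rule sum.mono_neutral_right)
    show "finite ?S" by (rule finite_vsplits)
    show "?h ` vsplits 1 [r] \<subseteq> ?S"
    proof
      fix p assume "p \<in> ?h ` vsplits 1 [r]"
      then obtain p' where p': "p' \<in> vsplits 1 [r]" "p = ?h p'" by blast
      obtain s t where st: "p' = ([s], [t])" "s + t = r"
        using vsplits_1E[OF p'(1)] .
      have "p = (vscale s \<beta>, vscale t \<beta>)" using p'(2) unfolding st(1) by simp
      then show "p \<in> ?S"
        using len vscale_add[of s t \<beta>] st(2) by (simp add: vsplits_def Nvec_def)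
    qed
    show "\<forall>p\<in>?S - ?h ` vsplits 1 [r]. (case p of (\<delta>, \<epsilon>) \<Rightarrow> ?G \<delta> x * ?G \<epsilon> y) = 0"
    proof
      fix p assume p: "p \<in> ?S - ?h ` vsplits 1 [r]"
      obtain \<delta> \<epsilon> where p_eq: "p = (\<delta>, \<epsilon>)" by (cases p)
      then have split: "(\<delta>, \<epsilon>) \<in> ?S" using p by simp
      \<comment> \<open>If both parts were on the ray, their multipliers would add up to
        \<open>r\<close>, as the point determines \<open>r\<close>, and the decomposition would be
        in the image of \<open>?h\<close>.\<close>
      have "(\<forall>s. vscale s \<beta> \<noteq> \<delta>) \<or> (\<forall>t. vscale t \<beta> \<noteq> \<epsilon>)"
      proof (rule ccontr)
        assume "\<not> ?thesis"
        then obtain s t where st: "vscale s \<beta> = \<delta>" "vscale t \<beta> = \<epsilon>" by blast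
        then have "vscale (s + t) \<beta> = vscale r \<beta>"
          using vsplitsD(4)[OF split] by (simp only: vscale_add)
        then have "([s], [t]) \<in> vsplits 1 [r]"
          using vscale_primitive_eq_iff[OF assms(1) assms(1), of "s + t" r]
            vsplits_1_iff[of "[s]" "[t]" r] by blast
        then have "?h ([s], [t]) \<in> ?h ` vsplits 1 [r]" by (rule imageI)
        moreover have "?h ([s], [t]) = p" unfolding p_eq using st by simp
        ultimately show False using p by (simp only: Diff_iff simp_thms)
      qed
      then have "?G \<delta> x = 0 \<or> ?G \<epsilon> y = 0"
        using psi_act_off_ray[OF vsplits_in(1)[OF assms(2) split], of \<beta> E]
          psi_act_off_ray[OF vsplits_in(2)[OF assms(2) split], of \<beta> E] by auto
      then show "(case p of (\<delta>, \<epsilon>) \<Rightarrow> ?G \<delta> x * ?G \<epsilon> y) = 0"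
        using p_eq by auto
    qed
  qed
  also have "\<dots> = (\<Sum>(\<sigma>, \<tau>)\<in>vsplits 1 [r]. E \<sigma> x * E \<tau> y)"
  proof (subst sum.reindex[OF inj], rule sum.cong[OF refl])
    fix p assume p: "p \<in> vsplits 1 [r]"
    obtain s t where st: "p = ([s], [t])" "s + t = r"
      using vsplits_1E[OF p] .
    then have "s \<le> r" "t \<le> r" by simp_all
    then have mem: "vscale s \<beta> \<in> \<Delta>" "vscale t \<beta> \<in> \<Delta>"
      using vle_in[OF assms(2) vle_vscale] by blast+
    show "((\<lambda>(\<delta>, \<epsilon>). ?G \<delta> x * ?G \<epsilon> y) \<circ> ?h) p = (case p of (\<sigma>, \<tau>) \<Rightarrow> E \<sigma> x * E \<tau> y)"
      using psi_act_vscale[OF assms(1) mem(1), of E] psi_act_vscale[OF assms(1) mem(2), of E]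
      unfolding st(1) by simp
  qed
  finally show ?thesis
    unfolding leibniz_defect_def psi_act_vscale[OF assms] by simp
qed

text \<open>Two points of the ray add up to a point of the ray, so every decomposition of \<alpha>
  has a part at which the family vanishes.\<close>

lemma leibniz_defect_psi_act_off_ray:
  assumes "\<alpha> \<in> \<Delta>" "\<forall>r. vscale r \<beta> \<noteq> \<alpha>"
  shows "leibniz_defect q (psi_act \<Delta> \<beta> E) \<alpha> x y = 0"
proof -
  have "(\<Sum>(\<delta>, \<epsilon>)\<in>vsplits q \<alpha>. psi_act \<Delta> \<beta> E \<delta> x * psi_act \<Delta> \<beta> E \<epsilon> y) = (\<Sum>(\<delta>, \<epsilon>)\<in>vsplits q \<alpha>. 0)"
  proof (rule sum_pairs_cong)
    fix \<delta> \<epsilon> assume *: "(\<delta>, \<epsilon>) \<in> vsplits q \<alpha>"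
    have "(\<forall>s. vscale s \<beta> \<noteq> \<delta>) \<or> (\<forall>t. vscale t \<beta> \<noteq> \<epsilon>)"
    proof (rule ccontr)
      assume "\<not> ?thesis"
      then obtain s t where "vscale s \<beta> = \<delta>" "vscale t \<beta> = \<epsilon>" by blast
      then have "vscale (s + t) \<beta> = \<alpha>"
        using vsplitsD(4)[OF *] by (simp only: vscale_add)
      then show False using assms(2) by blast
    qed
    then show "psi_act \<Delta> \<beta> E \<delta> x * psi_act \<Delta> \<beta> E \<epsilon> y = 0"
      using psi_act_off_ray[OF vsplits_in(1)[OF assms(1) *], of \<beta> E]
        psi_act_off_ray[OF vsplits_in(2)[OF assms(1) *], of \<beta> E] by auto
  qed
  also have "\<dots> = 0" by (simp add: split_def)
  finally show ?thesis
    using psi_act_off_ray[OF assms, of E] by (simp add: leibniz_defect_def)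
qed

text \<open>The multipliers that keep \<beta> in the co-ideal form an initial segment containing 0,
  so the number of positive ones is also the largest one. This identifies the index set in
  \<open>HS1\<close> with the part of the ray inside \<Delta>.\<close>

lemma vscale_in_iff_ray_length:
  assumes "\<beta> \<in> primitive q" "finite \<Delta>"
  shows "vscale r \<beta> \<in> \<Delta> \<longleftrightarrow> enat r \<le> ray_length \<Delta> \<beta>"
proof -
  let ?N = "{n. 0 < n \<and> vscale n \<beta> \<in> \<Delta>}"
  have ray: "ray \<Delta> \<beta> = (\<lambda>n. vscale n \<beta>) ` ?N" by (auto simp: ray_def)
  have inj: "inj_on (\<lambda>n. vscale n \<beta>) ?N"
    using vscale_primitive_eq_iff[OF assms(1) assms(1)] by (intro inj_onI) blast
  have fin: "finite (ray \<Delta> \<beta>)" using assms(2) by (simp add: ray_def)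
  then have finN: "finite ?N" using inj ray finite_imageD by metis
  have len: "ray_length \<Delta> \<beta> = enat (card ?N)"
    unfolding ray_length_def using fin ray card_image[OF inj] by simp
  have closed: "vscale m \<beta> \<in> \<Delta>" if "vscale n \<beta> \<in> \<Delta>" "m \<le> n" for m n
    using that vle_in vle_vscale by blast
  have "vscale r \<beta> \<in> \<Delta> \<longleftrightarrow> r \<le> card ?N"
  proof
    assume "vscale r \<beta> \<in> \<Delta>"
    then have "{1..r} \<subseteq> ?N" using closed by auto
    from card_mono[OF finN this] show "r \<le> card ?N" by simp
  next
    assume le: "r \<le> card ?N"
    show "vscale r \<beta> \<in> \<Delta>"
    proof (rule ccontr)
      assume notin: "vscale r \<beta> \<notin> \<Delta>"
      have "n < r" if "vscale n \<beta> \<in> \<Delta>" for n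
        using closed[OF that, of r] notin by linarith
      \<comment> \<open>All multipliers lie below \<open>r\<close>, so at most \<open>r - 1\<close>
        of them are positive; the subtraction is not truncated, since 0 lies in \<Delta> and hence
        \<open>r \<noteq> 0\<close>.\<close>
      then have "?N \<subseteq> {1..<r}" by auto
      from card_mono[OF _ this] have "card ?N \<le> r - 1" by simp
      moreover have "r \<noteq> 0" using notin vzero_in vscale_0[OF primitiveD(1)[OF assms(1)]] by metis
      ultimately show False using le by simp
    qed
  qed
  then show ?thesis by (simp add: len)
qed

section \<open>Trivial factors and supports of products\<close>

lemma HS_comp_trivial_left:
  assumes "\<alpha> \<in> \<Delta>" "G (vzero q) = id"
    and "\<And>\<delta>. vle \<delta> \<alpha> \<Longrightarrow> \<delta> \<noteq> vzero q \<Longrightarrow> G \<delta> = (\<lambda>x. 0)"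
  shows "HS_comp q \<Delta> G H \<alpha> = H \<alpha>"
proof
  fix x
  have mem: "(vzero q, \<alpha>) \<in> vsplits q \<alpha>"
    using length_in[OF assms(1)] by (simp add: vsplits_def Nvec_def vadd_vzero)
  have "(\<Sum>(\<delta>, \<epsilon>)\<in>vsplits q \<alpha> - {(vzero q, \<alpha>)}. G \<delta> (H \<epsilon> x)) =
      (\<Sum>(\<delta>, \<epsilon>)\<in>vsplits q \<alpha> - {(vzero q, \<alpha>)}. 0)"
  proof (rule sum_pairs_cong)
    fix \<delta> \<epsilon> assume *: "(\<delta>, \<epsilon>) \<in> vsplits q \<alpha> - {(vzero q, \<alpha>)}"
    then have split: "(\<delta>, \<epsilon>) \<in> vsplits q \<alpha>" by simp
    have "\<delta> \<noteq> vzero q"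
      using * vsplitsD(4)[OF split] vadd_vzero(1)[OF vsplitsD(2)[OF split]] by fastforce
    then show "G \<delta> (H \<epsilon> x) = 0" using assms(3) vsplitsD(6)[OF split] by simp
  qed
  then show "HS_comp q \<Delta> G H \<alpha> x = H \<alpha> x"
    unfolding HS_comp_apply[OF assms(1)] sum.remove[OF finite_vsplits mem]
    using assms(2) by (simp add: split_def)
qed

text \<open>Triviality is asked only at nonzero indices \<le> \<alpha>, the only ones that the
  component at \<alpha> sees. This fits the vanishing hypothesis of the last claim, which is
  restricted in the same way.\<close>

lemma HS_prod_append_trivial:
  assumes "\<alpha> \<in> \<Delta>" "\<And>G. G \<in> set Gs \<Longrightarrow> G (vzero q) = id"
    and "\<And>G \<delta>. G \<in> set Gs \<Longrightarrow> vle \<delta> \<alpha> \<Longrightarrow> \<delta> \<noteq> vzero q \<Longrightarrow> G \<delta> = (\<lambda>x. 0)"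
  shows "HS_prod q \<Delta> (Gs @ Hs) \<alpha> = HS_prod q \<Delta> Hs \<alpha>"
  using assms(2,3)
proof (induction Gs)
  case Nil
  show ?case by simp
next
  case (Cons G Gs)
  have "HS_prod q \<Delta> ((G # Gs) @ Hs) \<alpha> = HS_prod q \<Delta> (Gs @ Hs) \<alpha>"
    unfolding append_Cons HS_prod_Cons
    by (rule HS_comp_trivial_left[OF assms(1)]; use Cons.prems in \<open>meson list.set_intros(1)\<close>)
  also have "\<dots> = HS_prod q \<Delta> Hs \<alpha>"
    by (rule Cons.IH; use Cons.prems in \<open>meson list.set_intros(2)\<close>)
  finally show ?case .
qed

text \<open>A decomposition of an index outside the monoid \<open>W\<close> has a part outside
  \<open>W\<close>. If that part belongs to the inner product, linearity of the outer component
  sends the resulting zero to zero. The intended \<open>W\<close> consists of 0 and the vectors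
  above a ray.\<close>

lemma HS_prod_support:
  assumes "\<And>G \<delta>. G \<in> set Gs \<Longrightarrow> \<delta> \<in> \<Delta> \<Longrightarrow> klinear scale (G \<delta>)"
    and "\<And>G \<delta>. G \<in> set Gs \<Longrightarrow> \<delta> \<in> \<Delta> \<Longrightarrow> \<delta> \<notin> W \<Longrightarrow> G \<delta> = (\<lambda>x. 0)"
    and "vzero q \<in> W" "\<And>\<delta> \<epsilon>. \<delta> \<in> W \<Longrightarrow> \<epsilon> \<in> W \<Longrightarrow> vadd \<delta> \<epsilon> \<in> W"
    and "\<alpha> \<in> \<Delta>" "\<alpha> \<notin> W"
  shows "HS_prod q \<Delta> Gs \<alpha> = (\<lambda>x. 0)"
  using assms(1,2,5,6)
proof (induction Gs arbitrary: \<alpha>)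
  case Nil
  then have "\<alpha> \<noteq> vzero q" using assms(3) by blast
  then show ?case using Nil.prems(3) by (simp add: HS_one_def)
next
  case (Cons G Gs)
  show ?case
  proof
    fix x
    have "(\<Sum>(\<delta>, \<epsilon>)\<in>vsplits q \<alpha>. G \<delta> (HS_prod q \<Delta> Gs \<epsilon> x)) = (\<Sum>(\<delta>, \<epsilon>)\<in>vsplits q \<alpha>. 0)"
    proof (rule sum_pairs_cong)
      fix \<delta> \<epsilon> assume *: "(\<delta>, \<epsilon>) \<in> vsplits q \<alpha>"
      note mem = vsplits_in[OF Cons.prems(3) *]
      have "\<delta> \<notin> W \<or> \<epsilon> \<notin> W" using assms(4) Cons.prems(4) vsplitsD(4)[OF *] by blast
      then show "G \<delta> (HS_prod q \<Delta> Gs \<epsilon> x) = 0"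
      proof
        assume "\<delta> \<notin> W"
        then show ?thesis using Cons.prems(2)[of G \<delta>] mem by simp
      next
        assume "\<epsilon> \<notin> W"
        then have "HS_prod q \<Delta> Gs \<epsilon> = (\<lambda>x. 0)"
          using mem by (intro Cons.IH; use Cons.prems in \<open>meson list.set_intros(2)\<close>)
        moreover have "klinear scale (G \<delta>)" using Cons.prems(1) mem by simp
        ultimately show ?thesis using klinear_0 by simp
      qed
    qed
    then show "HS_prod q \<Delta> (G # Gs) \<alpha> x = 0"
      using HS_comp_apply[OF Cons.prems(3), of G "HS_prod q \<Delta> Gs" x] by (simp add: split_def)
  qed
qed

end

section \<open>Factorization along rays\<close>

locale ray_enumeration = pointed_coideal +
  fixes C :: nat and \<beta> :: "nat \<Rightarrow> nat list"
  assumes finite_coideal: "finite \<Delta>" and bij: "bij_betw \<beta> {1..C} (prims q \<Delta>)"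
begin

definition ray_prod :: "(nat \<Rightarrow> nat list \<Rightarrow> 'a \<Rightarrow> 'a) \<Rightarrow> nat list \<Rightarrow> 'a::{comm_ring, monoid_mult} \<Rightarrow> 'a"
  where "ray_prod E = HS_prod q \<Delta> (map (\<lambda>i. psi_act \<Delta> (\<beta> i) (E i)) [1..<Suc C])"

lemma set_indices: "set [1..<Suc C] = {1..C}"
  by auto

lemma primitive_ray:
  assumes "i \<in> {1..C}"
  shows "\<beta> i \<in> primitive q" "\<beta> i \<in> \<Delta>"
  using bij_betwE[OF bij, THEN bspec, OF assms] by (simp_all add: prims_def)

lemma length_ray: "i \<in> {1..C} \<Longrightarrow> length (\<beta> i) = q"
  by (rule primitiveD(1)[OF primitive_ray(1)])

lemma ray_unique:
  assumes "i \<in> {1..C}" "j \<in> {1..C}" "vscale r (\<beta> i) = vscale s (\<beta> j)" "r > 0"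
  shows "i = j"
proof -
  have "\<beta> i = \<beta> j"
    using vscale_primitive_eq_iff[OF primitive_ray(1)[OF assms(1)] primitive_ray(1)[OF assms(2)], of r s]
      assms(3,4) by blast
  then show ?thesis using inj_onD[OF bij_betw_imp_inj_on[OF bij]] assms(1,2) by blast
qed

lemma ray_cases:
  assumes "\<alpha> \<in> \<Delta>" "\<alpha> \<noteq> vzero q"
  obtains i r where "i \<in> {1..C}" "r > 0" "\<alpha> = vscale r (\<beta> i)"
proof -
  obtain \<kappa> where \<kappa>: "\<kappa> \<in> primitive q" "\<alpha> = vscale (vgcd \<alpha>) \<kappa>" "vgcd \<alpha> > 0" "vle \<kappa> \<alpha>"
    using obtain_primitive[OF length_in[OF assms(1)] assms(2)] .
  then have "\<kappa> \<in> prims q \<Delta>" using vle_in[OF assms(1)] by (simp add: prims_def)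
  then have "\<kappa> \<in> \<beta> ` {1..C}" using bij by (simp add: bij_betw_def)
  then obtain i where "i \<in> {1..C}" "\<kappa> = \<beta> i" by blast
  then show thesis using that \<kappa> by blast
qed

text \<open>Only multiples inside \<Delta> enter the product, so components defined everywhere can
  stand in for extensional families.\<close>

lemma ray_prod_cong:
  assumes "\<And>i r. i \<in> {1..C} \<Longrightarrow> vscale r (\<beta> i) \<in> \<Delta> \<Longrightarrow> E i [r] = E' i [r]"
  shows "ray_prod E = ray_prod E'"
proof -
  have "map (\<lambda>i. psi_act \<Delta> (\<beta> i) (E i)) [1..<Suc C] = map (\<lambda>i. psi_act \<Delta> (\<beta> i) (E' i)) [1..<Suc C]"
  proof (rule map_cong[OF refl])
    fix i assume "i \<in> set [1..<Suc C]"
    then have "i \<in> {1..C}" using set_indices by blast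
    then show "psi_act \<Delta> (\<beta> i) (E i) = psi_act \<Delta> (\<beta> i) (E' i)"
      using assms by (intro psi_act_cong)
  qed
  then show ?thesis unfolding ray_prod_def by (rule arg_cong)
qed

lemma ray_prod_vzero:
  assumes "\<And>i. i \<in> {1..C} \<Longrightarrow> E i [0] = id"
  shows "ray_prod E (vzero q) = id"
  unfolding ray_prod_def
proof (rule HS_prod_vzero, rule ballI)
  fix G assume "G \<in> set (map (\<lambda>i. psi_act \<Delta> (\<beta> i) (E i)) [1..<Suc C])"
  then obtain i where "i \<in> {1..C}" "G = psi_act \<Delta> (\<beta> i) (E i)"
    unfolding set_map set_indices by blast
  then show "G (vzero q) = id" using psi_act_vzero primitive_ray assms by blast
qed

text \<open>A nonzero point lies on one ray only, so a single term survives in the sum of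
  differences given by \<open>HS_prod_diff\<close>.\<close>

lemma ray_prod_diff:
  assumes "i \<in> {1..C}" "r > 0" "vscale r (\<beta> i) \<in> \<Delta>"
    and "\<And>j. j \<in> {1..C} \<Longrightarrow> E j [0] = id" "\<And>j. j \<in> {1..C} \<Longrightarrow> E' j [0] = id"
    and "\<And>j s. j \<in> {1..C} \<Longrightarrow> vscale s (\<beta> j) \<in> \<Delta> \<Longrightarrow>
      sum_list (vscale s (\<beta> j)) < sum_list (vscale r (\<beta> i)) \<Longrightarrow> E j [s] = E' j [s]"
  shows "ray_prod E (vscale r (\<beta> i)) x - ray_prod E' (vscale r (\<beta> i)) x = E i [r] x - E' i [r] x"
proof -
  let ?\<alpha> = "vscale r (\<beta> i)" and ?G = "\<lambda>i. psi_act \<Delta> (\<beta> i) (E i)" and ?G' = "\<lambda>i. psi_act \<Delta> (\<beta> i) (E' i)"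
  have "ray_prod E ?\<alpha> x - ray_prod E' ?\<alpha> x = (\<Sum>j\<leftarrow>[1..<Suc C]. ?G j ?\<alpha> x - ?G' j ?\<alpha> x)"
    unfolding ray_prod_def
  proof (rule HS_prod_diff[OF assms(3)], unfold set_indices)
    show "?\<alpha> \<noteq> vzero q"
      using vscale_eq_vzero_iff[OF primitive_ray(1)[OF assms(1)]] assms(2) by simp
    show "?G j (vzero q) = id" "?G' j (vzero q) = id" if "j \<in> {1..C}" for j
      using psi_act_vzero primitive_ray(1) assms(4,5) that by blast+
    show "?G j \<delta> = ?G' j \<delta>" if "j \<in> {1..C}" "\<delta> \<in> \<Delta>" "sum_list \<delta> < sum_list ?\<alpha>" for j \<delta>
    proof (cases "\<exists>s. vscale s (\<beta> j) = \<delta>")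
      case True
      then obtain s where "vscale s (\<beta> j) = \<delta>" ..
      then show ?thesis
        using psi_act_vscale[OF primitive_ray(1)[OF that(1)], of s "E j"]
          psi_act_vscale[OF primitive_ray(1)[OF that(1)], of s "E' j"] that assms(6)[of j s] by auto
    next
      case False
      then show ?thesis
        using psi_act_off_ray[OF that(2), of "\<beta> j" "E j"] psi_act_off_ray[OF that(2), of "\<beta> j" "E' j"] by simp
    qed
  qed
  also have "\<dots> = ?G i ?\<alpha> x - ?G' i ?\<alpha> x"
  proof (rule sum_list_single)
    show "i \<in> set [1..<Suc C]" using assms(1) set_indices by blast
    fix j assume j: "j \<in> set [1..<Suc C]" "j \<noteq> i"
    have "\<forall>s. vscale s (\<beta> j) \<noteq> ?\<alpha>"
      using ray_unique[of i j r] assms(1,2) j unfolding set_indices by metis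
    then show "?G j ?\<alpha> x - ?G' j ?\<alpha> x = 0"
      using psi_act_off_ray[OF assms(3), of "\<beta> j" "E j"] psi_act_off_ray[OF assms(3), of "\<beta> j" "E' j"] by simp
  qed simp
  finally show ?thesis
    unfolding psi_act_vscale[OF primitive_ray(1)[OF assms(1)] assms(3)] .
qed

text \<open>Once the families agree in smaller degrees, \<open>ray_prod_diff\<close> turns equality
  of the products into equality of the components in the present degree.\<close>

lemma ray_prod_inj:
  assumes "\<And>j. j \<in> {1..C} \<Longrightarrow> E j [0] = id" "\<And>j. j \<in> {1..C} \<Longrightarrow> E' j [0] = id"
    and "ray_prod E = ray_prod E'"
    and "i \<in> {1..C}" "vscale r (\<beta> i) \<in> \<Delta>"
  shows "E i [r] = E' i [r]"
  using assms(4,5)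
proof (induction "sum_list (vscale r (\<beta> i))" arbitrary: i r rule: less_induct)
  case less
  show ?case
  proof (cases "r = 0")
    case True
    then show ?thesis using assms(1,2) less.prems by simp
  next
    case False
    have "E i [r] x - E' i [r] x = 0" for x
      using ray_prod_diff[of i r E E' x] less False assms(1-3) by simp
    then show ?thesis by (simp add: fun_eq_iff)
  qed
qed

text \<open>All unknown components are packed into one function \<open>F\<close> on vectors, whose
  value at the \<open>r\<close>-th multiple of \<open>\<beta> i\<close> is the \<open>r\<close>-th
  component on the \<open>i\<close>-th ray. The rays do not compete for values of \<open>F\<close>:
  they meet only in 0, where every component is the identity.\<close>

lemma exists_ray_components:
  assumes alg: "comm_algebra scale" and D: "D \<in> HS scale q \<Delta>"
  shows "\<exists>F. (\<forall>\<alpha>. klinear scale (F \<alpha>)) \<and> F (vzero q) = id \<and>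
    (\<forall>\<alpha>\<in>\<Delta>. ray_prod (\<lambda>i \<rho>. F (vscale (hd \<rho>) (\<beta> i))) \<alpha> = D \<alpha>)"
proof -
  interpret comm_algebra scale by fact
  let ?E = "\<lambda>F i \<rho>. F (vscale (hd \<rho>) (\<beta> i))"
  have D0: "D (vzero q) = id"
    using D unfolding HS_iff by (elim conjE)
  have Dlin: "klinear scale (D \<alpha>)" if "\<alpha> \<in> \<Delta>" for \<alpha>
    using D PiE_mem[OF _ that] unfolding HS_iff by blast
  have unit: "?E F i [0] = id" if "F (vzero q) = id" "i \<in> {1..C}" for F i
    using that(1) by (simp only: list.sel vscale_0[OF length_ray[OF that(2)]])
  have "\<exists>F. (\<forall>\<alpha>. klinear scale (F \<alpha>)) \<and> F (vzero q) = id \<and>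
      (\<forall>\<alpha>\<in>\<Delta>. sum_list \<alpha> \<le> n \<longrightarrow> ray_prod (?E F) \<alpha> = D \<alpha>)" for n
  proof (induction n)
    case 0
    \<comment> \<open>Starting values: the prescribed identity at 0, and zero elsewhere, to be
      corrected degree by degree.\<close>
    let ?F = "\<lambda>\<alpha>. if \<alpha> = vzero q then id else (\<lambda>x. 0)"
    have "ray_prod (?E ?F) \<alpha> = D \<alpha>" if "\<alpha> \<in> \<Delta>" "sum_list \<alpha> \<le> 0" for \<alpha>
    proof -
      have "\<alpha> = vzero q" using that sum_list_eq_0_iff_vzero[OF length_in[OF that(1)]] by blast
      moreover have "ray_prod (?E ?F) (vzero q) = id"
        by (rule ray_prod_vzero, rule unit[of ?F], rule if_P[OF refl])
      ultimately show ?thesis using D0 by (simp only:)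
    qed
    moreover have "klinear scale (?F \<alpha>)" for \<alpha>
      by (simp add: klinear_id klinear_zero)
    ultimately show ?case
      by (intro exI[of _ ?F] conjI allI ballI impI if_P[OF refl])
  next
    case (Suc n)
    then obtain F where IH: "(\<forall>\<alpha>. klinear scale (F \<alpha>)) \<and> F (vzero q) = id \<and>
        (\<forall>\<alpha>\<in>\<Delta>. sum_list \<alpha> \<le> n \<longrightarrow> ray_prod (?E F) \<alpha> = D \<alpha>)" ..
    note F = IH[THEN conjunct1, THEN spec] IH[THEN conjunct2, THEN conjunct1]
      IH[THEN conjunct2, THEN conjunct2, THEN bspec, THEN mp]
    \<comment> \<open>In degree \<open>Suc n\<close> the discrepancy between \<open>D\<close> and
      the current product is added. A component enters the product in its own degree additively,
      with coefficient one, so that degree becomes exact and smaller degrees stay as they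
      were.\<close>
    let ?F = "\<lambda>\<alpha>. if \<alpha> \<in> \<Delta> \<and> sum_list \<alpha> = Suc n
      then (\<lambda>x. F \<alpha> x + (D \<alpha> x - ray_prod (?E F) \<alpha> x)) else F \<alpha>"
    have Elin: "klinear scale (ray_prod (?E F) \<alpha>)" if "\<alpha> \<in> \<Delta>" for \<alpha>
      unfolding ray_prod_def
    proof (rule klinear_HS_prod[OF alg that])
      fix G \<delta> assume "G \<in> set (map (\<lambda>i. psi_act \<Delta> (\<beta> i) (?E F i)) [1..<Suc C])" "\<delta> \<in> \<Delta>"
      then obtain i where i: "i \<in> {1..C}" "G = psi_act \<Delta> (\<beta> i) (?E F i)"
        unfolding set_map set_indices by blast
      show "klinear scale (G \<delta>)"
        unfolding i(2) by (rule klinear_psi_act[OF alg primitive_ray(1)[OF i(1)] \<open>\<delta> \<in> \<Delta>\<close>], rule F(1))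
    qed
    have lin: "klinear scale (?F \<alpha>)" for \<alpha>
    proof (cases "\<alpha> \<in> \<Delta> \<and> sum_list \<alpha> = Suc n")
      case True
      show ?thesis
        unfolding if_P[OF True] by (rule klinear_add_diff[OF F(1) Dlin Elin]) (use True in blast)+
    next
      case False
      show ?thesis unfolding if_not_P[OF False] by (rule F(1))
    qed
    have zero: "?F (vzero q) = id"
    proof -
      have "sum_list (vzero q) = 0" using sum_list_eq_0_iff_vzero[OF length_vzero, of q] by blast
      then have "\<not> (vzero q \<in> \<Delta> \<and> sum_list (vzero q) = Suc n)" by linarith
      then show ?thesis unfolding F(2) by (rule if_not_P)
    qed
    have "ray_prod (?E ?F) \<alpha> = D \<alpha>" if \<alpha>: "\<alpha> \<in> \<Delta>" "sum_list \<alpha> \<le> Suc n" for \<alpha>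
    proof (cases "\<alpha> = vzero q")
      case True
      moreover have "ray_prod (?E ?F) (vzero q) = id"
        by (rule ray_prod_vzero, rule unit[of ?F, OF zero])
      ultimately show ?thesis using D0 by (simp only:)
    next
      case False
      obtain i r where ir: "i \<in> {1..C}" "r > 0" "\<alpha> = vscale r (\<beta> i)"
        using ray_cases[OF \<alpha>(1) False] .
      have diff: "ray_prod (?E ?F) \<alpha> x - ray_prod (?E F) \<alpha> x = ?F \<alpha> x - F \<alpha> x" for x
      proof -
        have "ray_prod (?E ?F) (vscale r (\<beta> i)) x - ray_prod (?E F) (vscale r (\<beta> i)) x
          = ?E ?F i [r] x - ?E F i [r] x"
        proof (rule ray_prod_diff[OF ir(1,2)])
          show "vscale r (\<beta> i) \<in> \<Delta>" using \<alpha> ir by simp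
          show "?E ?F j [0] = id" if "j \<in> {1..C}" for j using unit[of ?F j, OF zero that] .
          show "?E F j [0] = id" if "j \<in> {1..C}" for j using unit[of F, OF F(2) that] .
          show "?E ?F j [s] = ?E F j [s]"
            if "sum_list (vscale s (\<beta> j)) < sum_list (vscale r (\<beta> i))" for j s
            using that \<alpha>(2) ir(3) by simp
        qed
        then show ?thesis using ir(3) by simp
      qed
      show ?thesis
      proof (cases "sum_list \<alpha> = Suc n")
        case True
        then have "ray_prod (?E ?F) \<alpha> x - ray_prod (?E F) \<alpha> x = D \<alpha> x - ray_prod (?E F) \<alpha> x" for x
          using diff[of x] \<alpha>(1) by simp
        then show ?thesis by (simp add: fun_eq_iff)
      next
        case False
        then have "ray_prod (?E ?F) \<alpha> x - ray_prod (?E F) \<alpha> x = 0" for x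
          using diff[of x] by simp
        then have "ray_prod (?E ?F) \<alpha> = ray_prod (?E F) \<alpha>" by (simp add: fun_eq_iff)
        then show ?thesis using F(3)[OF \<alpha>(1)] \<alpha>(2) False by simp
      qed
    qed
    then show ?case using lin zero by (intro exI[of _ ?F] conjI allI ballI impI)
  qed
  \<comment> \<open>Finiteness of \<Delta> bounds the degrees, so one stage of the construction
    matches \<open>D\<close> everywhere.\<close>
  from this[of "Max (sum_list ` \<Delta>)"] obtain F where all: "(\<forall>\<alpha>. klinear scale (F \<alpha>)) \<and> F (vzero q) = id \<and>
      (\<forall>\<alpha>\<in>\<Delta>. sum_list \<alpha> \<le> Max (sum_list ` \<Delta>) \<longrightarrow> ray_prod (?E F) \<alpha> = D \<alpha>)" ..
  note F = all[THEN conjunct1, THEN spec] all[THEN conjunct2, THEN conjunct1]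
    all[THEN conjunct2, THEN conjunct2, THEN bspec, THEN mp]
  have "ray_prod (?E F) \<alpha> = D \<alpha>" if "\<alpha> \<in> \<Delta>" for \<alpha>
    using F(3)[OF that] that finite_coideal by simp
  then show ?thesis using F(1,2) by (intro exI[of _ F] conjI allI ballI)
qed

text \<open>All factors are Leibniz below \<open>\<alpha>\<close>, so the Leibniz defect of the product at \<open>\<alpha>\<close>, which is that
  of \<open>D\<close> and hence zero, is the defect of the only factor with a component on the ray of \<open>\<alpha>\<close>.\<close>

lemma leibniz_ray_components:
  assumes alg: "comm_algebra scale" and D: "D \<in> HS scale q \<Delta>"
    and unit: "\<And>j. j \<in> {1..C} \<Longrightarrow> E j [0] = id"
    and lin: "\<And>j s. j \<in> {1..C} \<Longrightarrow> vscale s (\<beta> j) \<in> \<Delta> \<Longrightarrow> klinear scale (E j [s])"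
    and prod: "\<And>\<alpha>. \<alpha> \<in> \<Delta> \<Longrightarrow> ray_prod E \<alpha> = D \<alpha>"
    and "i \<in> {1..C}" "\<alpha> \<in> \<Delta>"
  shows "leibniz_defect q (psi_act \<Delta> (\<beta> i) (E i)) \<alpha> x y = 0"
  using assms(6,7)
\<comment> \<open>The claim is proved for all \<open>i\<close> at once, because additivity of the
  defect at \<alpha> needs the rule in smaller degrees for every factor.\<close>
proof (induction "sum_list \<alpha>" arbitrary: \<alpha> i x y rule: less_induct)
  case less
  let ?G = "\<lambda>i. psi_act \<Delta> (\<beta> i) (E i)"
  have G0: "?G j (vzero q) = id" if "j \<in> {1..C}" for j
    using psi_act_vzero primitive_ray(1) unit that by blast
  show ?case
  proof (cases "\<exists>r. vscale r (\<beta> i) = \<alpha>")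
    case False
    then have "\<forall>r. vscale r (\<beta> i) \<noteq> \<alpha>" by simp
    then show ?thesis by (rule leibniz_defect_psi_act_off_ray[OF less.prems(2)])
  next
    case True
    then obtain r where r: "vscale r (\<beta> i) = \<alpha>" ..
    show ?thesis
    proof (cases "r = 0")
      case True
      then have "\<alpha> = vzero q" using r[symmetric] vscale_0[OF length_ray[OF less.prems(1)]] by (simp only:)
      then show ?thesis
        using leibniz_defect_vzero[of "?G i", OF G0[OF less.prems(1)]] by (simp only:)
    next
      case False
      then have "\<alpha> \<noteq> vzero q"
        unfolding r[symmetric] vscale_eq_vzero_iff[OF primitive_ray(1)[OF less.prems(1)]] .
      have "leibniz_defect q (ray_prod E) \<alpha> x y = (\<Sum>G\<leftarrow>map ?G [1..<Suc C]. leibniz_defect q G \<alpha> x y)"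
        unfolding ray_prod_def
      proof (rule leibniz_defect_HS_prod[OF alg less.prems(2) \<open>\<alpha> \<noteq> vzero q\<close>], unfold set_map set_indices)
        show "G (vzero q) = id" if "G \<in> ?G ` {1..C}" for G
          using that G0 by (elim imageE) (simp only:)
        show "klinear scale (G \<delta>)" if G: "G \<in> ?G ` {1..C}" "\<delta> \<in> \<Delta>" for G \<delta>
        proof -
          obtain j where j: "j \<in> {1..C}" "G = ?G j" using G(1) by (rule imageE)
          show ?thesis unfolding j(2)
            by (rule klinear_psi_act[OF alg primitive_ray(1)[OF j(1)] G(2)], rule lin[OF j(1)])
        qed
        show "leibniz_defect q G \<delta> x y = 0"
          if G: "G \<in> ?G ` {1..C}" "\<delta> \<in> \<Delta>" "sum_list \<delta> < sum_list \<alpha>" for G \<delta> x y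
        proof -
          obtain j where j: "j \<in> {1..C}" "G = ?G j" using G(1) by (rule imageE)
          show ?thesis unfolding j(2) by (rule less.hyps[OF G(3) j(1) G(2)])
        qed
      qed
      also have "\<dots> = (\<Sum>j\<leftarrow>[1..<Suc C]. leibniz_defect q (?G j) \<alpha> x y)"
        by (simp add: comp_def)
      also have "\<dots> = leibniz_defect q (?G i) \<alpha> x y"
      proof (rule sum_list_single)
        show "i \<in> set [1..<Suc C]" using less.prems(1) set_indices by blast
        fix j assume j: "j \<in> set [1..<Suc C]" "j \<noteq> i"
        have "\<forall>s. vscale s (\<beta> j) \<noteq> \<alpha>"
        proof (rule allI, rule notI)
          fix s assume "vscale s (\<beta> j) = \<alpha>"
          then have "vscale r (\<beta> i) = vscale s (\<beta> j)" using r by (simp only:)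
          moreover have "j \<in> {1..C}" using j(1) set_indices by blast
          ultimately have "i = j" using ray_unique[OF less.prems(1)] False by blast
          then show False using j(2) by blast
        qed
        then show "leibniz_defect q (?G j) \<alpha> x y = 0"
          by (rule leibniz_defect_psi_act_off_ray[OF less.prems(2)])
      qed simp
      finally have "leibniz_defect q (?G i) \<alpha> x y = leibniz_defect q (ray_prod E) \<alpha> x y" by simp
      also have "\<dots> = leibniz_defect q D \<alpha> x y"
      proof -
        have "(\<Sum>(\<delta>, \<epsilon>)\<in>vsplits q \<alpha>. ray_prod E \<delta> x * ray_prod E \<epsilon> y) =
            (\<Sum>(\<delta>, \<epsilon>)\<in>vsplits q \<alpha>. D \<delta> x * D \<epsilon> y)"
        proof (rule sum_pairs_cong)
          fix \<delta> \<epsilon> assume *: "(\<delta>, \<epsilon>) \<in> vsplits q \<alpha>"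
          then show "ray_prod E \<delta> x * ray_prod E \<epsilon> y = D \<delta> x * D \<epsilon> y"
            using prod vsplits_in[OF less.prems(2) *] by simp
        qed
        then show ?thesis using prod[OF less.prems(2)] by (simp add: leibniz_defect_def)
      qed
      also have "\<dots> = 0" using D less.prems(2) by (simp add: HS_iff)
      finally show ?thesis .
    qed
  qed
qed

end

section \<open>Existence and uniqueness of the one-variable derivations\<close>

context ray_enumeration
begin

lemma HS1_componentD:
  assumes "i \<in> {1..C}" "E \<in> HS1 scale (ray_length \<Delta> (\<beta> i))"
  shows "E [0] = id" "vscale r (\<beta> i) \<in> \<Delta> \<Longrightarrow> klinear scale (E [r])"
    "E \<in> extensional {[n] | n. vscale n (\<beta> i) \<in> \<Delta>}"
proof -
  let ?S = "{[n] | n. vscale n (\<beta> i) \<in> \<Delta>}"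
  have S: "{[n] | n. enat n \<le> ray_length \<Delta> (\<beta> i)} = ?S"
    unfolding vscale_in_iff_ray_length[OF primitive_ray(1)[OF assms(1)] finite_coideal] ..
  have E: "E \<in> ?S \<rightarrow>\<^sub>E Collect (klinear scale) \<and> E (vzero 1) = id \<and>
      (\<forall>\<alpha>\<in>?S. \<forall>x y. leibniz_defect 1 E \<alpha> x y = 0)"
    using assms(2) unfolding HS1_def S HS_iff .
  then show "E [0] = id" by (simp add: vzero_def)
  show "E \<in> extensional ?S" using E by (simp add: PiE_def)
  have "E \<in> ?S \<rightarrow> Collect (klinear scale)" using E by (simp add: PiE_def)
  then show "klinear scale (E [r])" if "vscale r (\<beta> i) \<in> \<Delta>"
    using that by blast
qed

lemma ray_factorization_unique:
  assumes "E \<in> (\<Pi>\<^sub>E i\<in>{1..C}. HS1 scale (ray_length \<Delta> (\<beta> i)))"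
    and "E' \<in> (\<Pi>\<^sub>E i\<in>{1..C}. HS1 scale (ray_length \<Delta> (\<beta> i)))"
    and "ray_prod E = ray_prod E'"
  shows "E = E'"
proof (rule PiE_ext[OF assms(1,2)])
  fix i assume i: "i \<in> {1..C}"
  note mem = PiE_mem[OF assms(1)] PiE_mem[OF assms(2)]
  show "E i = E' i"
  proof (rule extensionalityI)
    show "E i \<in> extensional {[n] | n. vscale n (\<beta> i) \<in> \<Delta>}"
      "E' i \<in> extensional {[n] | n. vscale n (\<beta> i) \<in> \<Delta>}"
      by (rule HS1_componentD(3)[OF i mem(1)[OF i]], rule HS1_componentD(3)[OF i mem(2)[OF i]])
    fix \<rho> assume "\<rho> \<in> {[n] | n. vscale n (\<beta> i) \<in> \<Delta>}"
    then obtain n where n: "\<rho> = [n]" "vscale n (\<beta> i) \<in> \<Delta>" by blast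
    show "E i \<rho> = E' i \<rho>"
      unfolding n(1)
    proof (rule ray_prod_inj[OF _ _ assms(3) i n(2)])
      show "E j [0] = id" if "j \<in> {1..C}" for j
        by (rule HS1_componentD(1)[OF that mem(1)[OF that]])
      show "E' j [0] = id" if "j \<in> {1..C}" for j
        by (rule HS1_componentD(1)[OF that mem(2)[OF that]])
    qed
  qed
qed

lemma ray_factorization_exists:
  assumes alg: "comm_algebra scale" and D: "D \<in> HS scale q \<Delta>"
  obtains E where "E \<in> (\<Pi>\<^sub>E i\<in>{1..C}. HS1 scale (ray_length \<Delta> (\<beta> i)))" "D = ray_prod E"
proof -
  obtain F where ex: "(\<forall>\<alpha>. klinear scale (F \<alpha>)) \<and> F (vzero q) = id \<and>
      (\<forall>\<alpha>\<in>\<Delta>. ray_prod (\<lambda>i \<rho>. F (vscale (hd \<rho>) (\<beta> i))) \<alpha> = D \<alpha>)"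
    using exists_ray_components[OF alg D] ..
  note F = ex[THEN conjunct1, THEN spec] ex[THEN conjunct2, THEN conjunct1]
    and prod = ex[THEN conjunct2, THEN conjunct2, THEN bspec]
  let ?S = "\<lambda>i. {[n] | n. enat n \<le> ray_length \<Delta> (\<beta> i)}"
  \<comment> \<open>Restricted twice: the families of the theorem are extensional in the ray index
    and in the multiplier.\<close>
  define E where "E = (\<lambda>i\<in>{1..C}. \<lambda>\<rho>\<in>?S i. F (vscale (hd \<rho>) (\<beta> i)))"
  note ray_iff = vscale_in_iff_ray_length[OF primitive_ray(1) finite_coideal]
  have E: "E i [r] = F (vscale r (\<beta> i))" if "i \<in> {1..C}" "vscale r (\<beta> i) \<in> \<Delta>" for i r
    using that ray_iff[OF that(1), of r] by (simp add: E_def)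
  have E_eq: "ray_prod E = ray_prod (\<lambda>i \<rho>. F (vscale (hd \<rho>) (\<beta> i)))"
    using E by (intro ray_prod_cong) simp
  have unit: "E j [0] = id" if "j \<in> {1..C}" for j
    using E[OF that, of 0] vscale_0[OF length_ray[OF that]] vzero_in F(2) by simp
  have leibniz: "leibniz_defect 1 (E i) [n] x y = 0" if "i \<in> {1..C}" "vscale n (\<beta> i) \<in> \<Delta>" for i n x y
  proof -
    have "leibniz_defect q (psi_act \<Delta> (\<beta> i) (E i)) (vscale n (\<beta> i)) x y = 0"
    proof (rule leibniz_ray_components[where E = E, OF alg D unit _ _ that])
      show "klinear scale (E j [s])" if "j \<in> {1..C}" "vscale s (\<beta> j) \<in> \<Delta>" for j s
        unfolding E[OF that] by (rule F(1))
      show "ray_prod E \<alpha> = D \<alpha>" if "\<alpha> \<in> \<Delta>" for \<alpha>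
        unfolding E_eq by (rule prod[OF that])
    qed
    then show ?thesis
      using leibniz_defect_psi_act[OF primitive_ray(1)[OF that(1)] that(2), of "E i" x y] by (simp only:)
  qed
  have "E i \<in> HS1 scale (ray_length \<Delta> (\<beta> i))" if i: "i \<in> {1..C}" for i
    unfolding HS1_def HS_iff
  proof (intro conjI ballI allI)
    show "E i \<in> ?S i \<rightarrow>\<^sub>E Collect (klinear scale)"
      using i F(1) by (simp add: E_def)
    show "E i (vzero 1) = id" using unit[OF i] by (simp add: vzero_def)
    fix \<alpha> x y assume "\<alpha> \<in> ?S i"
    then obtain n where n: "\<alpha> = [n]" "enat n \<le> ray_length \<Delta> (\<beta> i)" by blast
    then show "leibniz_defect 1 (E i) \<alpha> x y = 0"
      using leibniz[OF i] ray_iff[OF i, of n] by simp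
  qed
  moreover have "E i = undefined" if "i \<notin> {1..C}" for i
    unfolding E_def restrict_def using that by (rule if_not_P)
  ultimately have "E \<in> (\<Pi>\<^sub>E i\<in>{1..C}. HS1 scale (ray_length \<Delta> (\<beta> i)))"
    by (rule PiE_I)
  moreover have "D = ray_prod E"
  proof
    fix \<alpha>
    show "D \<alpha> = ray_prod E \<alpha>"
    proof (cases "\<alpha> \<in> \<Delta>")
      case True
      then show ?thesis using prod E_eq by simp
    next
      case False
      \<comment> \<open>Off \<Delta> both sides take the default value
        \<open>undefined\<close>.\<close>
      have "D \<in> \<Delta> \<rightarrow>\<^sub>E Collect (klinear scale)" using D unfolding HS_iff by (elim conjE)
      then have "D \<alpha> = undefined" using False by (rule PiE_arb)
      moreover have "ray_prod E \<alpha> = undefined"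
        unfolding ray_prod_def by (rule HS_prod_outside[OF False])
      ultimately show ?thesis by (simp only:)
    qed
  qed
  ultimately show thesis by (rule that)
qed

end

section \<open>The ordered product and the last claim\<close>

locale ordered_ray_enumeration = ray_enumeration +
  assumes two_le: "q \<ge> 2"
    and ordered: "\<And>i j. i \<in> {1..C} \<Longrightarrow> j \<in> {1..C} \<Longrightarrow> i < j \<Longrightarrow> \<beta> i \<prec> \<beta> j"
begin

text \<open>A sum of vectors above the ray of \<open>\<beta> i\<close> stays above it, so the later factors
  do not contribute to the components on that ray.\<close>

lemma HS_prod_from_ray:
  assumes alg: "comm_algebra scale" and i: "i \<in> {1..C}" and "r > 0" and mem: "vscale r (\<beta> i) \<in> \<Delta>"
    and unit: "\<And>j. j \<in> {1..C} \<Longrightarrow> E j [0] = id"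
    and lin: "\<And>j s. j \<in> {1..C} \<Longrightarrow> vscale s (\<beta> j) \<in> \<Delta> \<Longrightarrow> klinear scale (E j [s])"
  shows "HS_prod q \<Delta> (map (\<lambda>j. psi_act \<Delta> (\<beta> j) (E j)) [i..<Suc C]) (vscale r (\<beta> i)) = E i [r]"
proof -
  let ?G = "\<lambda>j. psi_act \<Delta> (\<beta> j) (E j)" and ?\<alpha> = "vscale r (\<beta> i)"
  let ?P = "HS_prod q \<Delta> (map ?G [Suc i..<Suc C])"
  \<comment> \<open>Zero is adjoined to make the region above the ray a monoid. Every later factor
    is supported in it, hence so is \<open>?P\<close>.\<close>
  define W where "W = insert (vzero q) {\<gamma>. length \<gamma> = q \<and> \<beta> i \<prec> \<gamma>}"
  have later: "j \<in> {1..C}" "i < j" if "j \<in> set [Suc i..<Suc C]" for j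
    using that i by auto
  have P0: "?P (vzero q) = id"
  proof (rule HS_prod_vzero, rule ballI)
    fix G assume "G \<in> set (map ?G [Suc i..<Suc C])"
    then obtain j where j: "j \<in> set [Suc i..<Suc C]" "G = ?G j" unfolding set_map by (rule imageE)
    show "G (vzero q) = id"
      unfolding j(2) by (rule psi_act_vzero[OF primitive_ray(1)[OF later(1)[OF j(1)]]], rule unit[OF later(1)[OF j(1)]])
  qed
  have P_support: "?P \<epsilon> = (\<lambda>x. 0)" if "\<epsilon> \<in> \<Delta>" "\<epsilon> \<notin> W" for \<epsilon>
  proof (rule HS_prod_support[where W = W and scale = scale, OF _ _ _ _ that])
    show "vzero q \<in> W" by (simp add: W_def)
    show "vadd \<delta> \<epsilon> \<in> W" if "\<delta> \<in> W" "\<epsilon> \<in> W" for \<delta> \<epsilon>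
    proof (cases "\<delta> = vzero q \<or> \<epsilon> = vzero q")
      case True
      have "length \<delta> = q" "length \<epsilon> = q" using that by (auto simp: W_def)
      then show ?thesis using True that vadd_vzero by metis
    next
      case False
      then have "length \<delta> = q" "length \<epsilon> = q" "\<beta> i \<prec> \<delta>" "\<beta> i \<prec> \<epsilon>" using that by (auto simp: W_def)
      then have "\<beta> i \<prec> vadd \<delta> \<epsilon>" using length_ray[OF i] two_le by (intro prec_vadd[where q = q] disjI1)
      then show ?thesis using \<open>length \<delta> = q\<close> \<open>length \<epsilon> = q\<close> by (simp add: W_def)
    qed
    fix G \<delta> assume "G \<in> set (map ?G [Suc i..<Suc C])" and \<delta>: "\<delta> \<in> \<Delta>"
    then obtain j where j: "j \<in> set [Suc i..<Suc C]" "G = ?G j" unfolding set_map by blast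
    note j' = later[OF j(1)]
    show "klinear scale (G \<delta>)"
      unfolding j(2) by (rule klinear_psi_act[OF alg primitive_ray(1)[OF j'(1)] \<delta>], rule lin[OF j'(1)])
    assume "\<delta> \<notin> W"
    have "\<forall>s. vscale s (\<beta> j) \<noteq> \<delta>"
    proof (rule allI, rule notI)
      fix s assume s: "vscale s (\<beta> j) = \<delta>"
      have "s \<noteq> 0"
      proof
        assume "s = 0"
        then have "\<delta> = vzero q" using s[symmetric] vscale_0[OF length_ray[OF j'(1)]] by (simp only:)
        then show False using \<open>\<delta> \<notin> W\<close> by (simp add: W_def)
      qed
      then have "\<beta> i \<prec> vscale s (\<beta> j)"
        using ordered[OF i j'] length_ray[OF i] length_ray[OF j'(1)] two_le
        by (intro prec_vscale[where q = q]) simp_all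
      then show False
        using s length_ray[OF j'(1)] \<open>\<delta> \<notin> W\<close> by (auto simp: W_def)
    qed
    then show "G \<delta> = (\<lambda>x. 0)"
      unfolding j(2) by (rule psi_act_off_ray[OF \<delta>])
  qed
  have split0: "(?\<alpha>, vzero q) \<in> vsplits q ?\<alpha>"
    using length_ray[OF i] by (simp add: vsplits_def Nvec_def vadd_vzero)
  have "HS_comp q \<Delta> (?G i) ?P ?\<alpha> x = E i [r] x" for x
  proof -
    \<comment> \<open>Only \<epsilon> = 0 contributes. For \<epsilon> outside \<open>W\<close> the
      tail vanishes. A nonzero \<epsilon> in \<open>W\<close> keeps \<delta> off the ray, for
      otherwise the sum, a point of the ray, would lie above the ray.\<close>
    have "(\<Sum>(\<delta>, \<epsilon>)\<in>vsplits q ?\<alpha> - {(?\<alpha>, vzero q)}. ?G i \<delta> (?P \<epsilon> x)) =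
        (\<Sum>(\<delta>, \<epsilon>)\<in>vsplits q ?\<alpha> - {(?\<alpha>, vzero q)}. 0)"
    proof (rule sum_pairs_cong)
      fix \<delta> \<epsilon> assume *: "(\<delta>, \<epsilon>) \<in> vsplits q ?\<alpha> - {(?\<alpha>, vzero q)}"
      then have split: "(\<delta>, \<epsilon>) \<in> vsplits q ?\<alpha>" by simp
      note in_\<Delta> = vsplits_in[OF mem split] and len = vsplitsD(1,2)[OF split]
      have "\<epsilon> \<noteq> vzero q"
      proof
        assume "\<epsilon> = vzero q"
        then have "\<delta> = ?\<alpha>" using vsplitsD(4)[OF split] vadd_vzero(2)[OF len(1)] by simp
        then show False using * \<open>\<epsilon> = vzero q\<close> by simp
      qed
      show "?G i \<delta> (?P \<epsilon> x) = 0"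
      proof (cases "\<epsilon> \<in> W")
        case False
        have "klinear scale (?G i \<delta>)"
          by (rule klinear_psi_act[OF alg primitive_ray(1)[OF i] in_\<Delta>(1)], rule lin[OF i])
        then show ?thesis using P_support[OF in_\<Delta>(2) False] klinear_0 by simp
      next
        case True
        then have prec: "\<beta> i \<prec> \<epsilon>" using \<open>\<epsilon> \<noteq> vzero q\<close> by (simp add: W_def)
        have "\<forall>s. vscale s (\<beta> i) \<noteq> \<delta>"
        proof (rule allI, rule notI)
          fix s assume s: "vscale s (\<beta> i) = \<delta>"
          have "\<beta> i \<prec> vadd \<epsilon> (vscale s (\<beta> i))"
            using prec length_ray[OF i] len(2) two_le by (rule prec_vadd_vscale)
          also have "vadd \<epsilon> (vscale s (\<beta> i)) = ?\<alpha>"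
            unfolding s vsplitsD(4)[OF split] by (rule vadd_commute)
          finally show False
            using not_prec_vscale_self[OF \<open>r > 0\<close>] length_ray[OF i] two_le by blast
        qed
        then show ?thesis using psi_act_off_ray[OF in_\<Delta>(1), of "\<beta> i" "E i"] by simp
      qed
    qed
    then have "HS_comp q \<Delta> (?G i) ?P ?\<alpha> x = ?G i ?\<alpha> (?P (vzero q) x)"
      unfolding HS_comp_apply[OF mem] sum.remove[OF finite_vsplits split0] by (simp add: split_def)
    also have "\<dots> = E i [r] x"
      unfolding P0 psi_act_vscale[OF primitive_ray(1)[OF i] mem] by simp
    finally show ?thesis .
  qed
  moreover have "[i..<Suc C] = i # [Suc i..<Suc C]"
    using i by (intro upt_conv_Cons) simp
  ultimately show ?thesis by (simp add: fun_eq_iff del: upt_Suc)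
qed

text \<open>Induction over the rays up to the \<open>a\<close>-th. At the points \<le> \<alpha> of
  an earlier ray the product vanishes by hypothesis, and the induction hypothesis identifies its
  components there with those of the corresponding factor. So the factors before the
  \<open>i\<close>-th are trivial in the relevant range and drop out;
  \<open>HS_prod_from_ray\<close> deals with the rest.\<close>

lemma ray_prod_on_first_ray:
  assumes alg: "comm_algebra scale" and a: "a \<in> {1..C}"
    and unit: "\<And>j. j \<in> {1..C} \<Longrightarrow> E j [0] = id"
    and lin: "\<And>j s. j \<in> {1..C} \<Longrightarrow> vscale s (\<beta> j) \<in> \<Delta> \<Longrightarrow> klinear scale (E j [s])"
    and "\<alpha> \<in> \<Delta>"
    and vanish: "\<And>\<gamma>. \<gamma> \<in> below q \<Delta> (\<beta> a) \<Longrightarrow> vle \<gamma> \<alpha> \<Longrightarrow> ray_prod E \<gamma> = (\<lambda>x. 0)"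
    and "i \<in> {1..a}" "r > 0" "vle (vscale r (\<beta> i)) \<alpha>"
  shows "ray_prod E (vscale r (\<beta> i)) = E i [r]"
  using assms(7-9)
proof (induction i arbitrary: r rule: less_induct)
  case (less i)
  let ?G = "\<lambda>j. psi_act \<Delta> (\<beta> j) (E j)" and ?\<gamma> = "vscale r (\<beta> i)"
  have i: "i \<in> {1..C}" using a less.prems(1) by simp
  have mem: "?\<gamma> \<in> \<Delta>" using vle_in[OF \<open>\<alpha> \<in> \<Delta>\<close> less.prems(3)] .
  have trivial: "?G j \<delta> = (\<lambda>x. 0)" if j: "j \<in> {1..<i}" and "vle \<delta> ?\<gamma>" "\<delta> \<noteq> vzero q" for j \<delta>
  proof (cases "\<exists>s. vscale s (\<beta> j) = \<delta>")
    case False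
    have "\<delta> \<in> \<Delta>" using vle_in[OF mem that(2)] .
    then show ?thesis using psi_act_off_ray[of \<delta> "\<beta> j" "E j"] False by simp
  next
    case True
    then obtain s where s: "vscale s (\<beta> j) = \<delta>" ..
    have j': "j \<in> {1..C}" "j < a" "j \<in> {1..a}" "j < i" using j a less.prems(1) by simp_all
    have in_\<Delta>: "vscale s (\<beta> j) \<in> \<Delta>" unfolding s using vle_in[OF mem that(2)] .
    have le: "vle (vscale s (\<beta> j)) \<alpha>" unfolding s using vle_trans[OF that(2) less.prems(3)] .
    \<comment> \<open>\<open>below\<close> contains positive multiples only, so the multiplier 0 has
      to be excluded before the vanishing hypothesis applies.\<close>
    have "s \<noteq> 0"
    proof
      assume "s = 0"
      then show False using s \<open>\<delta> \<noteq> vzero q\<close> vscale_0[OF length_ray[OF j'(1)]] by simp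
    qed
    then have "s > 0" by simp
    have "vscale s (\<beta> j) \<in> ray \<Delta> (\<beta> j)" using \<open>s > 0\<close> in_\<Delta> by (auto simp: ray_def)
    moreover have "\<beta> j \<in> prims q \<Delta>" using primitive_ray[OF j'(1)] by (simp add: prims_def)
    ultimately have "vscale s (\<beta> j) \<in> below q \<Delta> (\<beta> a)"
      using ordered[OF j'(1) a j'(2)] unfolding below_def by blast
    then have "ray_prod E (vscale s (\<beta> j)) = (\<lambda>x. 0)" using le by (rule vanish)
    then have "E j [s] = (\<lambda>x. 0)" using less.IH[OF j'(4,3) \<open>s > 0\<close> le] by (simp only:)
    then show ?thesis using psi_act_vscale[OF primitive_ray(1)[OF j'(1)] in_\<Delta>, of "E j"] unfolding s by (simp only:)
  qed
  have "[1..<Suc C] = [1..<i] @ [i..<Suc C]"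
    using i upt_add_eq_append[of 1 i "Suc C - i"] by simp
  then have "ray_prod E ?\<gamma> = HS_prod q \<Delta> (map ?G [1..<i] @ map ?G [i..<Suc C]) ?\<gamma>"
    unfolding ray_prod_def by (simp only: map_append)
  also have "\<dots> = HS_prod q \<Delta> (map ?G [i..<Suc C]) ?\<gamma>"
  proof (rule HS_prod_append_trivial[OF mem], unfold set_map set_upt)
    fix G assume "G \<in> ?G ` {1..<i}"
    then obtain j where j: "j \<in> {1..<i}" "G = ?G j" by (rule imageE)
    have j': "j \<in> {1..C}" using j(1) i by simp
    show "G (vzero q) = id"
      unfolding j(2) by (rule psi_act_vzero[OF primitive_ray(1)[OF j']], rule unit[OF j'])
    show "G \<delta> = (\<lambda>x. 0)" if "vle \<delta> ?\<gamma>" "\<delta> \<noteq> vzero q" for \<delta>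
      unfolding j(2) using trivial[OF j(1) that] .
  qed
  also have "\<dots> = E i [r]"
    using HS_prod_from_ray[where E = E, OF alg i less.prems(2) mem unit lin] .
  finally show ?case .
qed

end

theorem theorem3p2:
  fixes scale :: "'k::{comm_ring, monoid_mult} \<Rightarrow> 'a::{comm_ring, monoid_mult} \<Rightarrow> 'a"
    and q C :: nat
    and \<Delta> :: "nat list set"
    and D :: "nat list \<Rightarrow> 'a \<Rightarrow> 'a"
    and \<beta> :: "nat \<Rightarrow> nat list"
  assumes "comm_algebra scale"
    and "q \<ge> 2"
    and "coideal q \<Delta>" "finite \<Delta>" "\<Delta> \<noteq> {}" "\<Delta> \<noteq> {vzero q}"
    and "D \<in> HS scale q \<Delta>"
    and "C = card (prims q \<Delta>)"
    and "bij_betw \<beta> {1..C} (prims q \<Delta>)"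
    and "\<forall>i\<in>{1..C}. \<forall>j\<in>{1..C}. i < j \<longrightarrow> \<beta> i \<prec> \<beta> j"
  shows "(\<exists>!E. E \<in> (\<Pi>\<^sub>E i\<in>{1..C}. HS1 scale (ray_length \<Delta> (\<beta> i))) \<and>
            D = HS_prod q \<Delta> (map (\<lambda>i. psi_act \<Delta> (\<beta> i) (E i)) [1..<Suc C])) \<and>
         (\<forall>E. E \<in> (\<Pi>\<^sub>E i\<in>{1..C}. HS1 scale (ray_length \<Delta> (\<beta> i))) \<and>
            D = HS_prod q \<Delta> (map (\<lambda>i. psi_act \<Delta> (\<beta> i) (E i)) [1..<Suc C]) \<longrightarrow>
            (\<forall>a\<in>{1..C}. \<forall>\<alpha>\<in>ray \<Delta> (\<beta> a).
               (\<forall>\<gamma>\<in>below q \<Delta> (\<beta> a). vle \<gamma> \<alpha> \<longrightarrow> D \<gamma> = (\<lambda>x. 0)) \<longrightarrow>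
               (\<forall>r\<in>{0..vgcd \<alpha>}. E a [r] = D (vscale r (\<beta> a)))))"
proof -
  have "vzero q \<in> \<Delta>"
  proof -
    obtain \<alpha> where \<alpha>: "\<alpha> \<in> \<Delta>" using assms(5) by blast
    then have "length \<alpha> = q" using assms(3) by (auto simp: coideal_def Nvec_def)
    then have "vle (vzero q) \<alpha>" "vzero q \<in> Nvec q"
      by (simp_all add: vle_def list_all2_conv_all_nth Nvec_def)
    then show ?thesis using assms(3) \<alpha> unfolding coideal_def by blast
  qed
  then interpret ordered_ray_enumeration q \<Delta> C \<beta>
    using assms(2-4,9,10) by unfold_locales blast+
  let ?Fam = "\<Pi>\<^sub>E i\<in>{1..C}. HS1 scale (ray_length \<Delta> (\<beta> i))"
  have "\<exists>!E. E \<in> ?Fam \<and> D = ray_prod E"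
  proof (rule ex_ex1I)
    show "\<exists>E. E \<in> ?Fam \<and> D = ray_prod E"
      using ray_factorization_exists[OF assms(1,7)] by blast
    show "E = E'" if "E \<in> ?Fam \<and> D = ray_prod E" "E' \<in> ?Fam \<and> D = ray_prod E'" for E E'
      using ray_factorization_unique[of E scale E'] that by simp
  qed
  moreover have "E a [r] = D (vscale r (\<beta> a))"
    if E: "E \<in> ?Fam" and D: "D = ray_prod E" and a: "a \<in> {1..C}" and \<alpha>: "\<alpha> \<in> ray \<Delta> (\<beta> a)"
      and vanish: "\<forall>\<gamma>\<in>below q \<Delta> (\<beta> a). vle \<gamma> \<alpha> \<longrightarrow> D \<gamma> = (\<lambda>x. 0)"
      and r: "r \<in> {0..vgcd \<alpha>}"
    for E a \<alpha> r
  \<comment> \<open>The multiplier 0 is outside the scope of \<open>ray_prod_on_first_ray\<close>;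
    both sides are the identity there.\<close>
  proof (cases "r = 0")
    note mem = PiE_mem[OF E]
    case True
    have "E a [0] = id" by (rule HS1_componentD(1)[OF a mem[OF a]])
    moreover have "D (vzero q) = id" using assms(7) unfolding HS_iff by (elim conjE)
    ultimately show ?thesis using True vscale_0[OF length_ray[OF a]] by (simp only:)
  next
    note mem = PiE_mem[OF E]
    case False
    obtain n where n: "\<alpha> = vscale n (\<beta> a)" "\<alpha> \<in> \<Delta>" using \<alpha> by (auto simp: ray_def)
    \<comment> \<open>The gcd of \<alpha> is its multiplier on the primitive ray, so the bound on
      \<open>r\<close> puts the \<open>r\<close>-th multiple below \<alpha>.\<close>
    then have "vgcd \<alpha> = n" using primitiveD(3)[OF primitive_ray(1)[OF a]] by (simp add: vgcd_vscale)
    then have "vle (vscale r (\<beta> a)) \<alpha>" using r n vle_vscale by simp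
    then have "ray_prod E (vscale r (\<beta> a)) = E a [r]"
    proof (rule ray_prod_on_first_ray[OF assms(1) a _ _ n(2), rotated -1])
      show "E j [0] = id" if "j \<in> {1..C}" for j
        by (rule HS1_componentD(1)[OF that mem[OF that]])
      show "klinear scale (E j [s])" if "j \<in> {1..C}" "vscale s (\<beta> j) \<in> \<Delta>" for j s
        by (rule HS1_componentD(2)[OF that(1) mem[OF that(1)] that(2)])
      show "ray_prod E \<gamma> = (\<lambda>x. 0)" if "\<gamma> \<in> below q \<Delta> (\<beta> a)" "vle \<gamma> \<alpha>" for \<gamma>
        using vanish that D by simp
      show "a \<in> {1..a}" "r > 0" using a False by simp_all
    qed
    then show ?thesis using D by (simp only:)
  qed
  ultimately show ?thesis unfolding ray_prod_def by blast
qed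

end
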